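(* Let $p>3$ be a prime and $l$ an even integer with $0<l<p-1$. Then \[ T_{p,l}(s)\equiv\zeta_{p,l}(s)\pmod{p\mathbb{Z}_p}\quad\text{for all } s\in\mathbb{Z}_p, \] and, if $l\ne2$, $\Delta_{T_{p,l}}\equiv2\Delta_{\zeta_{p,l}}\pmod{p\mathbb{Z}_p}$. Moreover, $T_{p,l}(0)\in\mathbb{Z}_p^*$ if and only if $\zeta_{p,l}(0)\in\mathbb{Z}_p^*$, and $T_{p,l}\in\mathcal{W}^0_{p,2}$ if and only if $\zeta_{p,l}\in\mathcal{W}^0_{p,2}$.
   Context: For $a\in\mathbb{Z}_p^*$ let $q(a)=(a^{p-1}-1)/p$ and $u(a)=a^{p-1}\in1+p\mathbb{Z}_p$, with $u(a)^s=\sum_{k\ge0}(u(a)-1)^k\binom{s}{k}$ for $s\in\mathbb{Z}_p$. Define $T_{p,l}(s)=\sum_{a=1}^{p-1}a^l\,q(a)\,u(a)^s$. Let $B_n$ be the Bernoulli numbers ($z/(e^z-1)=\sum B_nz^n/n!$), so $\zeta(1-n)=-B_n/n$ for $n\ge2$. Let $\zeta_{p,l}$ be the unique continuous function $\mathbb{Z}_p\to\mathbb{Z}_p$ with $\zeta_{p,l}(s)=-(1-p^{n-1})B_n/n$ for $n=l+s(p-1)$, $s\in\mathbb{N}_0$ (this function exists and lies in $\mathcal{K}_{p,2}$). Let $\Delta^n f(s)=\sum_{k=0}^n\binom{n}{k}(-1)^{n-k}f(s+k)$; $\mathcal{K}_{p,2}$ is the set of $f:\mathbb{Z}_p\to\mathbb{Z}_p$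 with $\Delta^n f(s)\equiv0\pmod{p^n}$ for all $s$, $n\ge0$; for $f\in\mathcal{K}_{p,2}$, $\Delta_f(n)=\Delta^nf(0)/p^n$, and $\Delta_f$ is the integer in $[0,p)$ congruent to $\Delta_f(1)$ mod $p$. $\mathcal{W}^0_{p,2}$ is the set of $f\in\mathcal{K}_{p,2}$ with $f(0)\in p\mathbb{Z}_p$ and $\Delta_f\ne0$. *)

theory Defs
  imports
    Complex_Main
    "HOL-Computational_Algebra.Computational_Algebra"
    "Berlekamp_Zassenhaus.Finite_Field"
begin

text \<open>
  The prime \<open>p\<close> is the cardinality of the index type \<open>'p\<close>.  The ring is the inverse limit of
  the rings \<open>\<int>/p\<^sup>n\<int>\<close>: a \<open>p\<close>-adic integer is the coherent sequence of its least nonnegative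
  residues modulo \<open>p\<^sup>n\<close>.
\<close>

typedef (overloaded) ('p::prime_card) padic_int =
  "{x :: nat \<Rightarrow> int. \<forall>n. x n \<in> {0..<int CARD('p) ^ n} \<and> x (Suc n) mod int CARD('p) ^ n = x n}"
  morphisms residue_seq Abs_padic_int
proof
  have "0 < CARD('p)" using prime_card[where 'a='p] by (rule prime_gt_0_nat)
  then show "(\<lambda>_. 0) \<in> {x :: nat \<Rightarrow> int. \<forall>n. x n \<in> {0..<int CARD('p) ^ n} \<and>
      x (Suc n) mod int CARD('p) ^ n = x n}" by (simp del: zero_less_card_finite)
qed

setup_lifting type_definition_padic_int

lemma card_gt_1: "1 < int CARD('p::prime_card)"
  using prime_card[where 'a='p] prime_gt_1_nat by fastforce

lemma residue_seq_bounds: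
  "0 \<le> residue_seq (x :: 'p::prime_card padic_int) n"
  "residue_seq x n < int CARD('p) ^ n"
  and residue_seq_Suc_mod: "residue_seq x (Suc n) mod int CARD('p) ^ n = residue_seq x n"
  using residue_seq[of x] by auto

lemma residue_seq_mod:
  fixes x :: "'p::prime_card padic_int"
  assumes "m \<le> n"
  shows "residue_seq x n mod int CARD('p) ^ m = residue_seq x m"
  using assms
proof (induction n rule: dec_induct)
  case base
  show ?case using residue_seq_bounds[of x m] by simp
next
  case (step n)
  have "residue_seq x (Suc n) mod int CARD('p) ^ m
      = (residue_seq x (Suc n) mod int CARD('p) ^ n) mod int CARD('p) ^ m"
    using step.hyps by (simp add: mod_mod_cancel le_imp_power_dvd)
  then show ?case using step.IH by (simp add: residue_seq_Suc_mod)
qed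

lemma coherent_mod:
  fixes x :: "nat \<Rightarrow> int"
  assumes "\<And>n. x (Suc n) mod int CARD('p::prime_card) ^ n = x n mod int CARD('p) ^ n"
  shows "x n mod int CARD('p) ^ n \<in> {0..<int CARD('p) ^ n} \<and>
    x (Suc n) mod int CARD('p) ^ Suc n mod int CARD('p) ^ n = x n mod int CARD('p) ^ n"
proof -
  have "int CARD('p) ^ n dvd int CARD('p) ^ Suc n" by (intro le_imp_power_dvd) simp
  moreover have "0 < int CARD('p) ^ n" using card_gt_1[where 'p='p] by (intro zero_less_power) linarith
  ultimately show "x n mod int CARD('p) ^ n \<in> {0..<int CARD('p) ^ n} \<and>
    x (Suc n) mod int CARD('p) ^ Suc n mod int CARD('p) ^ n = x n mod int CARD('p) ^ n"
    using assms[of n] by (simp only: mod_mod_cancel atLeastLessThan_iff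
      pos_mod_sign pos_mod_bound simp_thms)
qed

instantiation padic_int :: (prime_card) comm_ring_1
begin

lift_definition zero_padic_int :: "'a padic_int" is "\<lambda>_. 0"
  using card_gt_1[where 'p='a] by simp

lift_definition one_padic_int :: "'a padic_int" is "\<lambda>n. 1 mod int CARD('a) ^ n"
  by (rule coherent_mod) simp

lift_definition plus_padic_int :: "'a padic_int \<Rightarrow> 'a padic_int \<Rightarrow> 'a padic_int"
  is "\<lambda>x y n. (x n + y n) mod int CARD('a) ^ n"
proof -
  fix x y :: "nat \<Rightarrow> int"
  assume "\<And>n. x n \<in> {0..<int CARD('a) ^ n} \<and> x (Suc n) mod int CARD('a) ^ n = x n"
    and "\<And>n. y n \<in> {0..<int CARD('a) ^ n} \<and> y (Suc n) mod int CARD('a) ^ n = y n"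
  then have "(x (Suc n) + y (Suc n)) mod int CARD('a) ^ n = (x n + y n) mod int CARD('a) ^ n" for n
    by (metis mod_add_eq)
  then show "(x n + y n) mod int CARD('a) ^ n \<in> {0..<int CARD('a) ^ n} \<and>
      (x (Suc n) + y (Suc n)) mod int CARD('a) ^ Suc n mod int CARD('a) ^ n = (x n + y n) mod int CARD('a) ^ n" for n
    by (rule coherent_mod)
qed

lift_definition minus_padic_int :: "'a padic_int \<Rightarrow> 'a padic_int \<Rightarrow> 'a padic_int"
  is "\<lambda>x y n. (x n - y n) mod int CARD('a) ^ n"
proof -
  fix x y :: "nat \<Rightarrow> int"
  assume "\<And>n. x n \<in> {0..<int CARD('a) ^ n} \<and> x (Suc n) mod int CARD('a) ^ n = x n"
    and "\<And>n. y n \<in> {0..<int CARD('a) ^ n} \<and> y (Suc n) mod int CARD('a) ^ n = y n"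
  then have "(x (Suc n) - y (Suc n)) mod int CARD('a) ^ n = (x n - y n) mod int CARD('a) ^ n" for n
    by (metis mod_diff_eq)
  then show "(x n - y n) mod int CARD('a) ^ n \<in> {0..<int CARD('a) ^ n} \<and>
      (x (Suc n) - y (Suc n)) mod int CARD('a) ^ Suc n mod int CARD('a) ^ n = (x n - y n) mod int CARD('a) ^ n" for n
    by (rule coherent_mod)
qed

lift_definition uminus_padic_int :: "'a padic_int \<Rightarrow> 'a padic_int"
  is "\<lambda>x n. (- x n) mod int CARD('a) ^ n"
proof -
  fix x :: "nat \<Rightarrow> int"
  assume "\<And>n. x n \<in> {0..<int CARD('a) ^ n} \<and> x (Suc n) mod int CARD('a) ^ n = x n"
  then have "(- x (Suc n)) mod int CARD('a) ^ n = (- x n) mod int CARD('a) ^ n" for n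
    by (metis mod_minus_eq)
  then show "(- x n) mod int CARD('a) ^ n \<in> {0..<int CARD('a) ^ n} \<and>
      (- x (Suc n)) mod int CARD('a) ^ Suc n mod int CARD('a) ^ n = (- x n) mod int CARD('a) ^ n" for n
    by (rule coherent_mod)
qed

lift_definition times_padic_int :: "'a padic_int \<Rightarrow> 'a padic_int \<Rightarrow> 'a padic_int"
  is "\<lambda>x y n. (x n * y n) mod int CARD('a) ^ n"
proof -
  fix x y :: "nat \<Rightarrow> int"
  assume "\<And>n. x n \<in> {0..<int CARD('a) ^ n} \<and> x (Suc n) mod int CARD('a) ^ n = x n"
    and "\<And>n. y n \<in> {0..<int CARD('a) ^ n} \<and> y (Suc n) mod int CARD('a) ^ n = y n"
  then have "(x (Suc n) * y (Suc n)) mod int CARD('a) ^ n = (x n * y n) mod int CARD('a) ^ n" for n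
    by (metis mod_mult_eq)
  then show "(x n * y n) mod int CARD('a) ^ n \<in> {0..<int CARD('a) ^ n} \<and>
      (x (Suc n) * y (Suc n)) mod int CARD('a) ^ Suc n mod int CARD('a) ^ n = (x n * y n) mod int CARD('a) ^ n" for n
    by (rule coherent_mod)
qed

instance
proof
  fix a b c :: "'a padic_int"
  show "a + b + c = a + (b + c)"
    by transfer (simp only: mod_add_left_eq mod_add_right_eq add.assoc)
  show "a + b = b + a"
    by transfer (simp only: add.commute)
  show "0 + a = a"
    by transfer (rule ext, simp)
  show "- a + a = 0"
    by transfer (rule ext, simp only: mod_add_left_eq add.left_inverse mod_0)
  show "a - b = a + - b"
    by transfer (rule ext, simp only: mod_add_right_eq diff_conv_add_uminus)
  show "a * b * c = a * (b * c)"
    by transfer (simp only: mod_mult_left_eq mod_mult_right_eq mult.assoc)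
  show "a * b = b * a"
    by transfer (simp only: mult.commute)
  show "1 * a = a"
    by transfer (rule ext, simp add: mod_mult_left_eq)
  show "(a + b) * c = a * c + b * c"
    by transfer (simp only: mod_mult_left_eq mod_add_eq distrib_right)
  show "(0 :: 'a padic_int) \<noteq> 1"
  proof transfer
    have "1 mod int CARD('a) ^ 1 \<noteq> 0" using card_gt_1[where 'p='a] by simp
    then show "(\<lambda>_. 0) \<noteq> (\<lambda>n. 1 mod int CARD('a) ^ n)" by metis
  qed
qed

end

lemma residue_seq_of_nat:
  "residue_seq (of_nat k :: 'p::prime_card padic_int) n = int k mod int CARD('p) ^ n"
  by (induction k)
    (simp_all add: zero_padic_int.rep_eq one_padic_int.rep_eq plus_padic_int.rep_eq mod_simps)

lemma of_nat_card_power_dvd_iff: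
  fixes x :: "'p::prime_card padic_int"
  shows "of_nat CARD('p) ^ n dvd x \<longleftrightarrow> residue_seq x n = 0"
proof
  assume "of_nat CARD('p) ^ n dvd x"
  then obtain y where "x = of_nat (CARD('p) ^ n) * y" unfolding dvd_def of_nat_power by blast
  then have "residue_seq x n = (int CARD('p) ^ n mod int CARD('p) ^ n * residue_seq y n) mod int CARD('p) ^ n"
    by (simp only: times_padic_int.rep_eq residue_seq_of_nat flip: of_nat_power)
  then show "residue_seq x n = 0" by simp
next
  let ?q = "int CARD('p)"
  have q: "1 < ?q" by (rule card_gt_1)
  assume x: "residue_seq x n = 0"
  define z where "z = (\<lambda>k. residue_seq x (n + k) div ?q ^ n)"
  have z: "residue_seq x (n + k) = ?q ^ n * z k" for k
  proof -
    have "residue_seq x (n + k) mod ?q ^ n = 0"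
      unfolding residue_seq_mod[OF le_add1] by (rule x)
    then have "?q ^ n dvd residue_seq x (n + k)" by (rule mod_0_imp_dvd)
    then show ?thesis unfolding z_def by (rule dvd_mult_div_cancel[symmetric])
  qed
  have pos: "0 < ?q ^ n" using q by (intro zero_less_power) linarith
  have bounds: "z k \<in> {0..<?q ^ k}" for k
  proof -
    have "0 \<le> ?q ^ n * z k" "?q ^ n * z k < ?q ^ n * ?q ^ k"
      using residue_seq_bounds[of x "n + k"] by (simp_all only: z power_add)
    then show ?thesis using pos
      by (simp only: zero_le_mult_iff mult_less_cancel_left_pos atLeastLessThan_iff) auto
  qed
  have coh: "z (Suc k) mod ?q ^ k = z k" for k
  proof -
    have "(?q ^ n * z (Suc k)) mod (?q ^ n * ?q ^ k) = ?q ^ n * z k"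
      using residue_seq_Suc_mod[of x "n + k"] unfolding add_Suc_right[symmetric] z power_add .
    then have "?q ^ n * (z (Suc k) mod ?q ^ k) = ?q ^ n * z k" unfolding mult_mod_right .
    then show ?thesis using pos by (simp only: mult_cancel_left) linarith
  qed
  define y :: "'p padic_int" where "y = Abs_padic_int z"
  have y: "residue_seq y = z"
    unfolding y_def using bounds coh by (intro Abs_padic_int_inverse) simp
  have "residue_seq x k = residue_seq (of_nat (CARD('p) ^ n) * y) k" for k
  proof -
    have "residue_seq x k = (?q ^ n * z k) mod ?q ^ k"
      using residue_seq_mod[of k "n + k" x, OF le_add2] unfolding z by (rule sym)
    then show ?thesis
      by (simp only: times_padic_int.rep_eq residue_seq_of_nat y mod_mult_left_eq flip: of_nat_power)
  qed
  then have "x = of_nat (CARD('p) ^ n) * y" by (intro residue_seq_inject[THEN iffD1] ext)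
  then show "of_nat CARD('p) ^ n dvd x" unfolding of_nat_power by (rule dvdI)
qed

lemma padic_int_eq_0_iff:
  fixes x :: "'p::prime_card padic_int"
  shows "x = 0 \<longleftrightarrow> (\<forall>n. of_nat CARD('p) ^ n dvd x)"
  unfolding of_nat_card_power_dvd_iff
  unfolding residue_seq_inject[symmetric] zero_padic_int.rep_eq fun_eq_iff ..

text \<open>
  Division is exact division; quotients that are not \<open>p\<close>-adic integers get the value \<open>0\<close>.
\<close>

instantiation padic_int :: (prime_card) idom_divide
begin

definition divide_padic_int :: "'a padic_int \<Rightarrow> 'a padic_int \<Rightarrow> 'a padic_int" where
  "divide_padic_int x y = (if y \<noteq> 0 \<and> y dvd x then THE z. x = z * y else 0)"

instance
proof
  fix a b :: "'a padic_int"
  let ?q = "int CARD('a)"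
  have nz: "a * b \<noteq> 0" if "a \<noteq> 0" "b \<noteq> 0" for a b :: "'a padic_int"
  proof -
    from that obtain m n where m: "residue_seq a m \<noteq> 0" and n: "residue_seq b n \<noteq> 0"
      unfolding padic_int_eq_0_iff of_nat_card_power_dvd_iff by blast
    let ?x = "residue_seq a (m + n)" and ?y = "residue_seq b (m + n)"
    have x: "\<not> ?q ^ m dvd ?x" and y: "\<not> ?q ^ n dvd ?y"
      using residue_seq_mod[of m "m + n" a] residue_seq_mod[of n "m + n" b] m n
      by (auto simp: dvd_eq_mod_eq_0)
    have "\<not> ?q ^ (m + n) dvd ?x * ?y"
    proof
      assume d: "?q ^ (m + n) dvd ?x * ?y"
      have p: "prime_elem ?q" using prime_card_int[where 'a='a] by (rule prime_imp_prime_elem)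
      have nz: "?x \<noteq> 0" "?y \<noteq> 0" using x y by auto
      have "m + n \<le> multiplicity ?q (?x * ?y)"
        using d nz p by (intro multiplicity_geI) (auto simp: prime_elem_def)
      also have "\<dots> = multiplicity ?q ?x + multiplicity ?q ?y"
        using p nz by (rule prime_elem_multiplicity_mult_distrib)
      finally have "m \<le> multiplicity ?q ?x \<or> n \<le> multiplicity ?q ?y" by linarith
      then show False using x y multiplicity_dvd'[of m ?q ?x] multiplicity_dvd'[of n ?q ?y] by blast
    qed
    then have "residue_seq (a * b) (m + n) \<noteq> 0"
      by (simp add: times_padic_int.rep_eq dvd_eq_mod_eq_0)
    then show ?thesis by (auto simp: zero_padic_int.rep_eq)
  qed
  show "a \<noteq> 0 \<Longrightarrow> b \<noteq> 0 \<Longrightarrow> a * b \<noteq> 0" by (rule nz)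
  show "a * b div b = a" if "b \<noteq> 0"
  proof -
    have "(THE z. a * b = z * b) = a"
    proof (rule the_equality)
      fix z assume "a * b = z * b"
      then have "(a - z) * b = 0" by (simp add: algebra_simps)
      then show "z = a" using nz[of "a - z" b] that by auto
    qed simp
    then show ?thesis using that by (simp add: divide_padic_int_def)
  qed
  show "a div 0 = 0" by (simp add: divide_padic_int_def)
qed

end

instance padic_int :: (prime_card) algebraic_semidom ..

instance padic_int :: (prime_card) ring_char_0
proof
  have "m = n" if eq: "(of_nat m :: 'a padic_int) = of_nat n" for m n
  proof -
    let ?N = "m + n"
    have "int ?N < int CARD('a) ^ ?N"
      using card_gt_1[where 'p='a] of_nat_less_two_power[of ?N, where 'a=int]
        power_mono[of 2 "int CARD('a)" ?N] by linarith
    then have lt: "int k < int CARD('a) ^ ?N" if "k \<le> ?N" for k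
      using that by linarith
    have "int m mod int CARD('a) ^ ?N = int n mod int CARD('a) ^ ?N"
      using arg_cong[OF eq, of "\<lambda>x. residue_seq x ?N"] by (simp add: residue_seq_of_nat)
    then show ?thesis using lt[of m] lt[of n] by simp
  qed
  then show "inj (of_nat :: nat \<Rightarrow> 'a padic_int)" by (rule injI)
qed

lemma finite_powers_dvd_padic_int:
  fixes x :: "'p::prime_card padic_int"
  assumes "x \<noteq> 0"
  shows "finite {n. of_nat CARD('p) ^ n dvd x}"
proof -
  obtain m where m: "\<not> of_nat CARD('p) ^ m dvd x" using assms unfolding padic_int_eq_0_iff by blast
  have "n < m" if "of_nat CARD('p) ^ n dvd x" for n
  proof (rule ccontr)
    assume "\<not> n < m"
    then have "of_nat CARD('p) ^ m dvd (of_nat CARD('p) ^ n :: 'p padic_int)"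
      by (intro le_imp_power_dvd) simp
    then have "of_nat CARD('p) ^ m dvd x" using that by (rule dvd_trans)
    with m show False ..
  qed
  then show ?thesis by (intro finite_subset[OF _ finite_lessThan[of m]] subsetI) simp
qed

text \<open>The \<open>p\<close>-adic valuation, only meaningful for nonzero arguments.\<close>

definition padic_val :: "'p::prime_card padic_int \<Rightarrow> nat" where
  "padic_val x = Max {n. of_nat CARD('p) ^ n dvd x}"

lemma padic_power_dvd_iff_le_padic_val:
  fixes x :: "'p::prime_card padic_int"
  assumes "x \<noteq> 0"
  shows "of_nat CARD('p) ^ n dvd x \<longleftrightarrow> n \<le> padic_val x"
proof -
  let ?A = "{n. of_nat CARD('p) ^ n dvd x}"
  have fin: "finite ?A" using assms by (rule finite_powers_dvd_padic_int)
  have "0 \<in> ?A" by simp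
  then have ne: "?A \<noteq> {}" by blast
  have val: "padic_val x = Max ?A" by (rule padic_val_def)
  have "Max ?A \<in> ?A" using fin ne by (rule Max_in)
  then have "of_nat CARD('p) ^ padic_val x dvd x" unfolding val by simp
  then have "of_nat CARD('p) ^ n dvd x" if "n \<le> padic_val x"
    using le_imp_power_dvd[OF that] by (rule dvd_trans[rotated])
  moreover have "n \<le> padic_val x" if "of_nat CARD('p) ^ n dvd x"
    unfolding val using that by (intro Max_ge[OF fin]) simp
  ultimately show ?thesis by blast
qed

instantiation padic_int :: (prime_card) metric_space
begin

definition dist_padic_int :: "'a padic_int \<Rightarrow> 'a padic_int \<Rightarrow> real" where
  "dist x y = (if x = y then 0
     else 1 / real CARD('a) ^ padic_val (x - y))"

definition uniformity_padic_int :: "('a padic_int \<times> 'a padic_int) filter" where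
  "uniformity_padic_int = (INF e\<in>{0<..}. principal {(x, y). dist x y < e})"

definition open_padic_int :: "'a padic_int set \<Rightarrow> bool" where
  "open_padic_int U \<longleftrightarrow> (\<forall>x\<in>U. \<forall>\<^sub>F (x', y) in uniformity. x' = x \<longrightarrow> y \<in> U)"

instance
proof
  fix x y z :: "'a padic_int"
  let ?v = "padic_val :: 'a padic_int \<Rightarrow> nat"
  have q: "1 < real CARD('a)" using card_gt_1[where 'p='a] by linarith
  show "uniformity = (INF e\<in>{0<..}. principal {(x :: 'a padic_int, y). dist x y < e})"
    by (rule uniformity_padic_int_def)
  show "open U \<longleftrightarrow> (\<forall>x\<in>U. \<forall>\<^sub>F (x', y) in uniformity. x' = x \<longrightarrow> y \<in> U)"
    for U :: "'a padic_int set" by (rule open_padic_int_def)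
  show "dist x y = 0 \<longleftrightarrow> x = y" using q by (simp add: dist_padic_int_def)
  show "dist x y \<le> dist x z + dist y z"
  proof (cases "x = y \<or> x = z \<or> y = z")
    case True
    have "?v (y - x) = ?v (x - y)" for x y :: "'a padic_int"
      unfolding padic_val_def using dvd_minus_iff[of _ "x - y"] by simp
    then show ?thesis using True q by (auto simp: dist_padic_int_def)
  next
    case False
    then have nz: "x - y \<noteq> 0" "x - z \<noteq> 0" "y - z \<noteq> 0" by auto
    let ?k = "min (?v (x - z)) (?v (y - z))"
    have "of_nat CARD('a) ^ ?k dvd (x - z) - (y - z)"
    proof (rule dvd_diff)
      show "of_nat CARD('a) ^ ?k dvd x - z" "of_nat CARD('a) ^ ?k dvd y - z"
        unfolding padic_power_dvd_iff_le_padic_val[OF nz(2)] padic_power_dvd_iff_le_padic_val[OF nz(3)]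
        by simp_all
    qed
    then have "?k \<le> ?v (x - y)" using nz by (simp add: padic_power_dvd_iff_le_padic_val)
    then have "1 / real CARD('a) ^ ?v (x - y) \<le> 1 / real CARD('a) ^ ?k"
      using q by (intro divide_left_mono power_increasing mult_pos_pos) auto
    also have "\<dots> \<le> 1 / real CARD('a) ^ ?v (x - z) + 1 / real CARD('a) ^ ?v (y - z)"
      using q by (simp add: min_def)
    finally show ?thesis using False by (simp add: dist_padic_int_def)
  qed
qed

end

text \<open>The type \<open>'p padic_int fract\<close> is the field of \<open>p\<close>-adic numbers, which contains the rationals.\<close>

instance fract :: ("{idom, ring_char_0}") field_char_0
proof
  show "inj (of_nat :: nat \<Rightarrow> 'a fract)"
    by (rule injI) (simp add: of_nat_fract eq_fract)
qed

definition fdiff :: "nat \<Rightarrow> ('p::prime_card padic_int \<Rightarrow> 'p padic_int) \<Rightarrow> 'p padic_int \<Rightarrow> 'p padic_int"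
  where "fdiff n f s = (\<Sum>k=0..n. of_nat (n choose k) * (-1) ^ (n - k) * f (s + of_nat k))"

text \<open>
  The space \<open>\<K>\<^sub>p\<^sub>,\<^sub>2\<close>; \<open>Delta f\<close> below is the invariant \<open>\<Delta>\<^sub>f \<in> [0,p)\<close>, and \<open>W0\<close> is \<open>\<W>\<^sup>0\<^sub>p\<^sub>,\<^sub>2\<close>.
\<close>

definition kummer_space :: "('p::prime_card padic_int \<Rightarrow> 'p padic_int) set" where
  "kummer_space = {f. \<forall>s n. of_nat CARD('p) ^ n dvd fdiff n f s}"

definition Delta_coeff :: "('p::prime_card padic_int \<Rightarrow> 'p padic_int) \<Rightarrow> nat \<Rightarrow> 'p padic_int" where
  "Delta_coeff f n = fdiff n f 0 div of_nat CARD('p) ^ n"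

definition Delta :: "('p::prime_card padic_int \<Rightarrow> 'p padic_int) \<Rightarrow> int" where
  "Delta f = (THE d. 0 \<le> d \<and> d < int CARD('p) \<and> of_nat CARD('p) dvd of_int d - Delta_coeff f 1)"

definition W0 :: "('p::prime_card padic_int \<Rightarrow> 'p padic_int) set" where
  "W0 = {f \<in> kummer_space. of_nat CARD('p) dvd f 0 \<and> Delta f \<noteq> 0}"

definition fermat_quotient :: "'p::prime_card padic_int \<Rightarrow> 'p padic_int" where
  "fermat_quotient a = (a ^ (CARD('p) - 1) - 1) div of_nat CARD('p)"

text \<open>
  The library's generalised binomial coefficient is restricted to fields by a syntactic sort
  constraint.  The division by \<open>k!\<close> is exact: binomial coefficients of \<open>p\<close>-adic integers are
  \<open>p\<close>-adic integers.
\<close>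

definition padic_binomial :: "'p::prime_card padic_int \<Rightarrow> nat \<Rightarrow> 'p padic_int" where
  "padic_binomial s k = (\<Prod>i=0..<k. s - of_nat i) div fact k"

text \<open>For \<open>u \<in> 1 + p\<int>\<^sub>p\<close> this is the \<open>p\<close>-adic power \<open>u\<^sup>s\<close>.\<close>

definition padic_pow :: "'p::prime_card padic_int \<Rightarrow> 'p padic_int \<Rightarrow> 'p padic_int" where
  "padic_pow u s = (\<Sum>k. (u - 1) ^ k * padic_binomial s k)"

definition T :: "nat \<Rightarrow> 'p::prime_card padic_int \<Rightarrow> 'p padic_int" where
  "T l s = (\<Sum>a=1..CARD('p) - 1. of_nat a ^ l * fermat_quotient (of_nat a) *
              padic_pow (of_nat a ^ (CARD('p) - 1)) s)"

definition bernoulli :: "nat \<Rightarrow> rat" where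
  "bernoulli n = fact n * fps_nth (fps_X / (fps_exp 1 - 1)) n"

text \<open>
  The function exists and is unique when \<open>p - 1\<close> does not divide \<open>l\<close> and \<open>l\<close> is positive.  The
  interpolated values \<open>(1 - p\<^sup>n\<^sup>-\<^sup>1) \<zeta>(1 - n)\<close> are rational, so the equation is stated in \<open>\<rat>\<^sub>p\<close>.
\<close>

definition zeta :: "nat \<Rightarrow> 'p::prime_card padic_int \<Rightarrow> 'p padic_int" where
  "zeta l = (THE f. continuous_on UNIV f \<and>
     (\<forall>s::nat. let n = l + s * (CARD('p) - 1) in
        to_fract (f (of_nat s)) =
          of_rat (- (1 - of_nat CARD('p) ^ (n - 1)) * bernoulli n / of_nat n)))"

end

theory Submission
  imports Defs "HOL-Number_Theory.Number_Theory"
begin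

text \<open>
  A Mahler series \<open>\<Sum> c\<^sub>k binom(s, k)\<close> with \<open>p\<^sup>k | c\<^sub>k\<close> converges, is continuous, lies in the Kummer space
  and is constant modulo \<open>p\<close>; its \<open>n\<close>-th difference is the series of the shifted coefficients.
  Both functions are of this kind: \<open>u\<^sup>s\<close> has the coefficients \<open>(u - 1)\<^sup>k\<close>, and \<open>\<zeta>\<^sub>p\<^sub>,\<^sub>l\<close> has as
  coefficients the differences of the interpolated values, which are divisible by \<open>p\<^sup>k\<close> by the
  Kummer congruences.

  With \<open>S\<^sub>n = \<Sum>\<^sub>a\<^sub><\<^sub>p a\<^sup>n\<close> and \<open>n = l + s (p - 1)\<close> one has
  \<open>T(s) = (S\<^bsub>n+p-1\<^esub> - S\<^sub>n) / p\<close>, which is congruent to \<open>B\<^bsub>n+p-1\<^esub> - B\<^sub>n\<close> modulo \<open>p\<close>, and modulo \<open>p\<^sup>2\<close> if \<open>l \<noteq> 2\<close>.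
  Substituting \<open>B\<^sub>n \<equiv> - n \<zeta>(s)\<close> and using the Kummer congruences gives \<open>T(0) \<equiv> \<zeta>(0)\<close> modulo \<open>p\<close>
  and \<open>T(1) - T(0) \<equiv> 2 (\<zeta>(1) - \<zeta>(0))\<close> modulo \<open>p\<^sup>2\<close>.  For \<open>l = 2\<close> neither function is in
  \<open>\<W>\<^sup>0\<close>, because \<open>\<zeta>(0) = (p - 1) / 12\<close> is a unit.
\<close>

section \<open>Congruences and convergence in the \<open>p\<close>-adic integers\<close>

lemma padic_dvd_diff_iff:
  fixes x y :: "'p::prime_card padic_int"
  shows "of_nat CARD('p) ^ n dvd x - y \<longleftrightarrow> residue_seq x n = residue_seq y n"
proof -
  have "residue_seq (x - y) n = 0 \<longleftrightarrow>
      residue_seq x n mod int CARD('p) ^ n = residue_seq y n mod int CARD('p) ^ n"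
    by (simp add: minus_padic_int.rep_eq mod_eq_dvd_iff mod_eq_0_iff_dvd)
  then show ?thesis
    using residue_seq_mod[of n n x] residue_seq_mod[of n n y]
    by (simp add: of_nat_card_power_dvd_iff)
qed

lemma padic_eqI:
  fixes x y :: "'p::prime_card padic_int"
  assumes "\<And>n. of_nat CARD('p) ^ n dvd x - y"
  shows "x = y"
  using assms padic_int_eq_0_iff[of "x - y"] by simp

text \<open>The \<open>n\<close>-th residue of \<open>x\<close> is itself such a number. This
  density of the naturals carries facts about them over to all of Z_p.\<close>

lemma padic_approx_nat:
  fixes x :: "'p::prime_card padic_int"
  shows "\<exists>m. of_nat CARD('p) ^ n dvd x - of_nat m"
proof -
  have "of_nat CARD('p) ^ n dvd x - of_nat (nat (residue_seq x n))"
    unfolding padic_dvd_diff_iff residue_seq_of_nat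
    using residue_seq_bounds[of x n] residue_seq_mod[of n n x] by simp
  then show ?thesis by blast
qed

text \<open>The dictionary between the metric and divisibility, on which the criteria for
  convergence and continuity below rest.\<close>

lemma dist_padic_le_iff:
  fixes x y :: "'p::prime_card padic_int"
  shows "dist x y \<le> 1 / real CARD('p) ^ n \<longleftrightarrow> of_nat CARD('p) ^ n dvd x - y"
proof (cases "x = y")
  case False
  have q: "1 < real CARD('p)" using card_gt_1[where 'p='p] by linarith
  have "dist x y \<le> 1 / real CARD('p) ^ n \<longleftrightarrow> n \<le> padic_val (x - y)"
    using q False by (simp add: dist_padic_int_def field_simps)
  then show ?thesis using False by (simp add: padic_power_dvd_iff_le_padic_val)
qed simp

lemma ex_inverse_card_power_less:
  assumes "0 < (e :: real)"
  shows "\<exists>n. 1 / real CARD('p::prime_card) ^ n < e"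
proof -
  have "1 < real CARD('p)" using card_gt_1[where 'p='p] by linarith
  then show ?thesis
    using real_arch_pow_inv[OF assms, of "1 / real CARD('p)"] by (simp add: power_divide)
qed

lemma padic_LIMSEQ_I:
  fixes X :: "nat \<Rightarrow> 'p::prime_card padic_int"
  assumes "\<And>n. of_nat CARD('p) ^ n dvd L - X n"
  shows "X \<longlonglongrightarrow> L"
proof (rule metric_LIMSEQ_I)
  fix e :: real assume "0 < e"
  then obtain N where N: "1 / real CARD('p) ^ N < e"
    using ex_inverse_card_power_less[where 'p='p] by blast
  have "dist (X n) L < e" if "n \<ge> N" for n
  proof -
    have "of_nat CARD('p) ^ N dvd L - X n"
      by (rule dvd_trans[OF le_imp_power_dvd[OF that] assms])
    then show ?thesis using N by (simp add: dist_commute flip: dist_padic_le_iff)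
  qed
  then show "\<exists>N. \<forall>n\<ge>N. dist (X n) L < e" by blast
qed

lemma continuous_padicI:
  fixes f :: "'p::prime_card padic_int \<Rightarrow> 'p padic_int"
  assumes "\<And>n. \<exists>m. \<forall>x y. of_nat CARD('p) ^ m dvd x - y \<longrightarrow> of_nat CARD('p) ^ n dvd f x - f y"
  shows "continuous_on UNIV f"
  unfolding continuous_on_def
proof (intro ballI metric_LIM_I)
  fix x e assume "(0::real) < e"
  then obtain n where n: "1 / real CARD('p) ^ n < e"
    using ex_inverse_card_power_less[where 'p='p] by blast
  obtain m where m: "\<And>x y. of_nat CARD('p) ^ m dvd x - y \<Longrightarrow> of_nat CARD('p) ^ n dvd f x - f y"
    using assms by blast
  have "dist (f y) (f x) < e" if "dist y x < 1 / real CARD('p) ^ m" for y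
    using m[of y x] that n by (simp flip: dist_padic_le_iff)
  moreover have "0 < 1 / real CARD('p) ^ m" by simp
  ultimately show "\<exists>d>0. \<forall>y. y \<noteq> x \<and> dist y x < d \<longrightarrow> dist (f y) (f x) < e" by blast
qed

text \<open>Every \<open>x\<close> is a limit of natural numbers, so continuity fixes the value at
  \<open>x\<close>. This is the uniqueness behind the \<open>THE\<close> in
  \<open>zeta\<close>.\<close>

lemma continuous_padic_eqI:
  fixes f g :: "'p::prime_card padic_int \<Rightarrow> 'p padic_int"
  assumes "continuous_on UNIV f" "continuous_on UNIV g" "\<And>m. f (of_nat m) = g (of_nat m)"
  shows "f = g"
proof
  fix x :: "'p padic_int"
  obtain m where m: "\<And>n. of_nat CARD('p) ^ n dvd x - of_nat (m n)"
    using padic_approx_nat[of _ x] by metis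
  have "(\<lambda>n. of_nat (m n)) \<longlonglongrightarrow> x"
    by (rule padic_LIMSEQ_I) (rule m)
  moreover have "f \<midarrow>x\<rightarrow> f x" "g \<midarrow>x\<rightarrow> g x" using assms by (simp_all add: continuous_on_def)
  ultimately have "(\<lambda>n. f (of_nat (m n))) \<longlonglongrightarrow> f x" "(\<lambda>n. g (of_nat (m n))) \<longlonglongrightarrow> g x"
    by (auto intro: tendsto_compose)
  then show "f x = g x" unfolding assms(3) by (rule LIMSEQ_unique)
qed

text \<open>Terms from index \<open>n\<close> on vanish modulo p^n, so the residues of the partial
  sums stabilise and form a coherent sequence. That sequence is the limit, and the error after
  \<open>n\<close> terms is known at once.\<close>

lemma padic_series_converges:
  fixes f :: "nat \<Rightarrow> 'p::prime_card padic_int"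
  assumes "\<And>k. of_nat CARD('p) ^ k dvd f k"
  shows "of_nat CARD('p) ^ n dvd (\<Sum>k. f k) - (\<Sum>k<n. f k)"
proof -
  let ?S = "\<lambda>n. \<Sum>k<n. f k"
  define z where "z n = residue_seq (?S n) n" for n
  have "residue_seq (?S (Suc n)) n = z n" for n
    using assms[of n] unfolding z_def padic_dvd_diff_iff[symmetric] by simp
  then have "z n \<in> {0..<int CARD('p) ^ n} \<and> z (Suc n) mod int CARD('p) ^ n = z n" for n
    using residue_seq_bounds[of "?S n" n] by (simp add: z_def residue_seq_Suc_mod)
  then have "residue_seq (Abs_padic_int z :: 'p padic_int) = z"
    by (intro Abs_padic_int_inverse) simp
  then have lim: "of_nat CARD('p) ^ n dvd (Abs_padic_int z :: 'p padic_int) - ?S n" for n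
    by (simp add: padic_dvd_diff_iff z_def)
  have "f sums Abs_padic_int z"
    unfolding sums_def by (rule padic_LIMSEQ_I) (rule lim)
  then have "(\<Sum>k. f k) = Abs_padic_int z" by (rule sums_unique[symmetric])
  with lim show ?thesis by simp
qed

section \<open>Integers and units in Z_p\<close>

lemma padic_power_dvd_of_int_iff:
  "of_nat CARD('p) ^ k dvd (of_int m :: 'p::prime_card padic_int) \<longleftrightarrow> int CARD('p) ^ k dvd m"
proof -
  have nat: "of_nat CARD('p) ^ k dvd (of_nat j :: 'p padic_int) \<longleftrightarrow> int CARD('p) ^ k dvd int j" for j
    by (simp add: of_nat_card_power_dvd_iff residue_seq_of_nat mod_eq_0_iff_dvd)
  show ?thesis using nat[of "nat \<bar>m\<bar>"] by (cases "m \<ge> 0") simp_all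
qed

text \<open>If \<open>x a \<equiv> 1\<close> modulo \<open>p\<close>, then \<open>x a = 1 - p z\<close> is inverted by a geometric series.\<close>

lemma padic_is_unit_iff:
  fixes x :: "'p::prime_card padic_int"
  shows "is_unit x \<longleftrightarrow> \<not> of_nat CARD('p) dvd x"
proof
  assume x: "is_unit x"
  have "\<not> int CARD('p) ^ 1 dvd 1" using card_gt_1[where 'p='p] by simp
  then have "\<not> is_unit (of_nat CARD('p) :: 'p padic_int)"
    using padic_power_dvd_of_int_iff[of 1 1, where 'p='p] by simp
  with x show "\<not> of_nat CARD('p) dvd x" using dvd_trans by blast
next
  let ?P = "of_nat CARD('p) :: 'p padic_int"
  assume x: "\<not> ?P dvd x"
  obtain m where "?P dvd x - of_nat m"
    using padic_approx_nat[of 1 x] by auto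
  then obtain w where "x - of_nat m = ?P * w" by (rule dvdE)
  then have w: "x = of_nat m + ?P * w" by (simp add: diff_eq_eq add.commute)
  have "\<not> CARD('p) dvd m"
  proof
    assume "CARD('p) dvd m"
    then obtain j where "m = CARD('p) * j" by (rule dvdE)
    then have "x = ?P * (of_nat j + w)" by (simp add: w distrib_left)
    with x show False by simp
  qed
  \<comment> \<open>Bezout gives an inverse \<open>b\<close> of the residue \<open>m\<close> modulo
    p, so \<open>x * of_int b\<close> differs from 1 by a multiple of p.\<close>
  then have "coprime (int CARD('p)) (int m)"
    using prime_card_int[where 'a='p] by (intro prime_imp_coprime) auto
  then obtain a b where "a * int CARD('p) + b * int m = 1"
    using bezout_int[of "int CARD('p)" "int m"] by auto
  then have ab: "int m * b + int CARD('p) * a = 1" by (simp add: mult.commute add.commute)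
  define z where "z = of_int a - w * of_int b"
  have "of_int (int m * b + int CARD('p) * a) = (1 :: 'p padic_int)" using ab by simp
  then have xa: "x * of_int b = 1 - ?P * z" by (simp add: z_def w algebra_simps)
  define G where "G = (\<Sum>k. (?P * z) ^ k)"
  have G: "?P ^ N dvd G - (\<Sum>k<N. (?P * z) ^ k)" for N
    unfolding G_def by (rule padic_series_converges) (simp add: power_mult_distrib)
  have "(1 - ?P * z) * G = 1"
  proof (rule padic_eqI)
    fix N
    have "(1 - ?P * z) * G - 1 = (1 - ?P * z) * (G - (\<Sum>k<N. (?P * z) ^ k)) - (?P * z) ^ N"
      using one_diff_power_eq[of "?P * z" N] by (simp add: algebra_simps)
    then show "?P ^ N dvd (1 - ?P * z) * G - 1"
      using G[of N] by (simp add: power_mult_distrib)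
  qed
  then have "x * (of_int b * G) = 1" by (simp add: xa flip: mult.assoc)
  then show "is_unit x" by (intro dvdI) (rule sym)
qed

lemma is_unit_padic_of_int:
  "\<not> int CARD('p) dvd n \<Longrightarrow> is_unit (of_int n :: 'p::prime_card padic_int)"
  using padic_power_dvd_of_int_iff[of 1 n, where 'p='p] by (simp add: padic_is_unit_iff)

text \<open>The factor of \<open>n\<close> prime to p is a unit. Applied to \<open>k!\<close>, this
  bounds the number of p-adic digits lost on dividing by \<open>k!\<close>.\<close>

lemma padic_of_nat_dvd_power:
  assumes "0 < n"
  shows "\<exists>v. (of_nat n :: 'p::prime_card padic_int) dvd of_nat CARD('p) ^ v"
proof -
  have "n \<noteq> 0" "\<not> is_unit CARD('p)" using assms prime_card[where 'a='p] by auto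
  then obtain q where q: "n = CARD('p) ^ multiplicity CARD('p) n * q" "\<not> CARD('p) dvd q"
    by (rule multiplicity_decompose')
  have "is_unit (of_nat q :: 'p padic_int)"
    using is_unit_padic_of_int[of "int q", where 'p='p] q(2) by simp
  moreover have "(of_nat n :: 'p padic_int) = of_nat CARD('p) ^ multiplicity CARD('p) n * of_nat q"
    by (subst q(1)) simp
  ultimately show ?thesis by (intro exI[of _ "multiplicity CARD('p) n"]) (simp add: mult_unit_dvd_iff)
qed

section \<open>Mahler series\<close>

lemma dvd_prod_diff:
  fixes s t :: "'a::comm_ring_1"
  shows "s - t dvd (\<Prod>i\<in>A. s - f i) - (\<Prod>i\<in>A. t - f i)"
proof (induction A rule: infinite_finite_induct)
  case (insert a A)
  have "(\<Prod>i\<in>insert a A. s - f i) - (\<Prod>i\<in>insert a A. t - f i) =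
      (s - f a) * ((\<Prod>i\<in>A. s - f i) - (\<Prod>i\<in>A. t - f i)) + (s - t) * (\<Prod>i\<in>A. t - f i)"
    using insert.hyps by (simp add: algebra_simps)
  then show ?case using insert.IH by simp
qed simp_all

lemma fact_mult_binomial_of_nat:
  "fact k * of_nat (m choose k) = (\<Prod>i=0..<k. of_nat m - of_nat i :: 'a::{comm_ring_1,semiring_char_0})"
proof (induction k)
  case (Suc k)
  have "Suc k * (m choose Suc k) = (m - k) * (m choose k)"
    by (simp only: binomial_absorption binomial_absorb_comp)
  then have "of_nat (Suc k) * of_nat (m choose Suc k) = (of_nat (m - k) * of_nat (m choose k) :: 'a)"
    by (metis of_nat_mult)
  \<comment> \<open>For \<open>k > m\<close> the truncated difference \<open>m - k\<close> is not
    the difference in the ring, but then the binomial coefficient is 0.\<close>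
  also have "\<dots> = (of_nat m - of_nat k) * of_nat (m choose k)"
    by (cases "k \<le> m") (simp_all add: of_nat_diff binomial_eq_0)
  finally have *: "of_nat (Suc k) * of_nat (m choose Suc k) = (of_nat m - of_nat k) * (of_nat (m choose k) :: 'a)" .
  have "fact (Suc k) * of_nat (m choose Suc k) = fact k * (of_nat (Suc k) * of_nat (m choose Suc k) :: 'a)"
    by (simp only: fact_Suc of_nat_mult mult_ac)
  also have "\<dots> = (of_nat m - of_nat k) * (fact k * of_nat (m choose k))"
    unfolding * by (simp only: mult_ac)
  finally have "fact (Suc k) * of_nat (m choose Suc k) =
      (of_nat m - of_nat k) * (fact k * of_nat (m choose k) :: 'a)" .
  then show ?case by (simp only: Suc.IH prod.atLeast0_lessThan_Suc mult.commute)
qed simp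

text \<open>Exactness of the division: if \<open>k!\<close> divides p^v, a natural number congruent
  to \<open>s\<close> modulo p^v has a falling factorial congruent modulo \<open>k!\<close>, and
  that one is \<open>k!\<close> times an ordinary binomial coefficient.\<close>

lemma fact_mult_padic_binomial:
  fixes s :: "'p::prime_card padic_int"
  shows "fact k * padic_binomial s k = (\<Prod>i=0..<k. s - of_nat i)"
proof -
  obtain v where v: "(fact k :: 'p padic_int) dvd of_nat CARD('p) ^ v"
    using padic_of_nat_dvd_power[of "fact k", where 'p='p] by auto
  obtain m where m: "of_nat CARD('p) ^ v dvd s - of_nat m" using padic_approx_nat by blast
  have "fact k dvd (\<Prod>i=0..<k. s - of_nat i) - (\<Prod>i=0..<k. of_nat m - of_nat i)"
    using v m dvd_prod_diff by (blast intro: dvd_trans)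
  then have "fact k dvd (\<Prod>i=0..<k. s - of_nat i)"
    by (metis dvd_add dvd_triv_left diff_add_cancel fact_mult_binomial_of_nat)
  then show ?thesis by (simp add: padic_binomial_def)
qed

lemma padic_binomial_0 [simp]: "padic_binomial s 0 = 1"
  using fact_mult_padic_binomial[of 0 s] by simp

lemma padic_binomial_0_left [simp]: "0 < k \<Longrightarrow> padic_binomial 0 k = (0 :: 'a::prime_card padic_int)"
proof -
  assume "0 < k"
  then have *: "(\<Prod>i=0..<k. 0 - of_nat i :: 'a padic_int) = 0"
    by (intro prod_zero) auto
  then show "padic_binomial 0 k = (0 :: 'a padic_int)"
    by (simp only: padic_binomial_def * div_0)
qed

text \<open>Pascal's rule, checked after multiplication by (k+1)!, where it is an identity of
  falling factorials.\<close>

lemma padic_binomial_Suc_Suc: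
  "padic_binomial (s + 1) (Suc k) = padic_binomial s (Suc k) + padic_binomial s k"
proof -
  have "fact (Suc k) * padic_binomial (s + 1) (Suc k) = (s + 1) * (fact k * padic_binomial s k)"
    unfolding fact_mult_padic_binomial by (simp add: prod.atLeast0_lessThan_Suc_shift del: prod.op_ivl_Suc)
  moreover have "fact (Suc k) * padic_binomial s (Suc k) = (s - of_nat k) * (fact k * padic_binomial s k)"
    unfolding fact_mult_padic_binomial by (simp add: mult.commute)
  ultimately have "fact (Suc k) * padic_binomial (s + 1) (Suc k) =
      fact (Suc k) * (padic_binomial s (Suc k) + padic_binomial s k)"
    by (simp add: algebra_simps)
  then show ?thesis by (simp only: mult_cancel_left fact_nonzero simp_thms)
qed

text \<open>Congruent arguments have congruent falling factorials, and the division by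
  \<open>k!\<close> costs at most \<open>v\<close> digits if \<open>k!\<close> divides p^v.\<close>

lemma padic_binomial_cong:
  "\<exists>v. \<forall>n (s :: 'p::prime_card padic_int) t. of_nat CARD('p) ^ (v + n) dvd s - t \<longrightarrow>
     of_nat CARD('p) ^ n dvd padic_binomial s k - padic_binomial t k"
proof -
  let ?P = "of_nat CARD('p) :: 'p padic_int"
  obtain v where "(fact k :: 'p padic_int) dvd ?P ^ v"
    using padic_of_nat_dvd_power[of "fact k", where 'p='p] by auto
  then obtain w where w: "?P ^ v = fact k * w" by (rule dvdE)
  have "?P ^ n dvd padic_binomial s k - padic_binomial t k" if st: "?P ^ (v + n) dvd s - t" for n s t
  proof -
    have "?P ^ v * (padic_binomial s k - padic_binomial t k) =
        w * ((\<Prod>i=0..<k. s - of_nat i) - (\<Prod>i=0..<k. t - of_nat i))"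
      unfolding w fact_mult_padic_binomial[symmetric] by (simp add: algebra_simps)
    moreover have "?P ^ (v + n) dvd w * ((\<Prod>i=0..<k. s - of_nat i) - (\<Prod>i=0..<k. t - of_nat i))"
      by (intro dvd_mult dvd_trans[OF st] dvd_prod_diff)
    ultimately have "?P ^ v * ?P ^ n dvd ?P ^ v * (padic_binomial s k - padic_binomial t k)"
      by (simp only: power_add)
    then show ?thesis by simp
  qed
  then show ?thesis by blast
qed

text \<open>The counterpart of \<open>fdiff\<close> for sequences over any commutative ring, so that
  it also applies to rational zeta values and integer powers.\<close>

definition fwd_diff :: "nat \<Rightarrow> (nat \<Rightarrow> 'a::comm_ring_1) \<Rightarrow> 'a" where
  "fwd_diff n g = (\<Sum>k=0..n. of_nat (n choose k) * (-1) ^ (n - k) * g k)"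

lemma fwd_diff_0 [simp]: "fwd_diff 0 g = g 0"
  by (simp add: fwd_diff_def)

text \<open>Pascal's rule splits each coefficient: the part \<open>n choose k\<close> gives the
  shifted sequence, the other part reassembles to the difference of lower order.\<close>

lemma fwd_diff_Suc: "fwd_diff (Suc n) g = fwd_diff n (\<lambda>k. g (Suc k)) - fwd_diff n g"
proof -
  have split: "(-1) ^ Suc n * g 0 + (\<Sum>k=0..n. of_nat (n choose Suc k) * (-1) ^ (n - k) * g (Suc k)) =
      (\<Sum>k=0..Suc n. of_nat (n choose k) * (-1) ^ (Suc n - k) * g k)"
    by (subst sum.atLeast0_atMost_Suc_shift) simp
  also have "\<dots> = (\<Sum>k=0..n. of_nat (n choose k) * (-1) ^ (Suc n - k) * g k)"
    by (simp add: binomial_eq_0)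
  also have "\<dots> = - fwd_diff n g"
    unfolding fwd_diff_def sum_negf[symmetric] by (intro sum.cong) (simp_all add: Suc_diff_le)
  finally have *: "(-1) ^ Suc n * g 0 + (\<Sum>k=0..n. of_nat (n choose Suc k) * (-1) ^ (n - k) * g (Suc k)) =
      - fwd_diff n g" .
  have "fwd_diff (Suc n) g =
      (-1) ^ Suc n * g 0 + (\<Sum>k=0..n. of_nat (Suc n choose Suc k) * (-1) ^ (n - k) * g (Suc k))"
    unfolding fwd_diff_def by (subst sum.atLeast0_atMost_Suc_shift) simp
  also have "\<dots> = fwd_diff n (\<lambda>k. g (Suc k)) - fwd_diff n g"
    using * by (simp add: fwd_diff_def algebra_simps sum.distrib)
  finally show ?thesis .
qed

lemma fdiff_eq_fwd_diff: "fdiff n f s = fwd_diff n (\<lambda>k. f (s + of_nat k))"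
  by (simp add: fdiff_def fwd_diff_def)

lemma fdiff_0 [simp]: "fdiff 0 f = f"
  by (rule ext) (simp add: fdiff_eq_fwd_diff)

lemma fdiff_Suc: "fdiff (Suc n) f s = fdiff n f (s + 1) - fdiff n f s"
  by (simp add: fdiff_eq_fwd_diff fwd_diff_Suc add_ac)

section \<open>Mahler series with coefficients c_k in p^k Z_p\<close>

definition mahler :: "(nat \<Rightarrow> 'p::prime_card padic_int) \<Rightarrow> 'p padic_int \<Rightarrow> 'p padic_int" where
  "mahler c s = (\<Sum>k. c k * padic_binomial s k)"

definition kummer_coeffs :: "(nat \<Rightarrow> 'p::prime_card padic_int) set" where
  "kummer_coeffs = {c. \<forall>k. of_nat CARD('p) ^ k dvd c k}"

lemma kummer_coeffsD:
  fixes c :: "nat \<Rightarrow> 'p::prime_card padic_int"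
  assumes "c \<in> kummer_coeffs" "n \<le> k"
  shows "of_nat CARD('p) ^ n dvd c k"
proof (rule dvd_trans)
  show "of_nat CARD('p) ^ n dvd (of_nat CARD('p) ^ k :: 'p padic_int)"
    using assms(2) by (rule le_imp_power_dvd)
  show "of_nat CARD('p) ^ k dvd c k" using assms(1) by (simp add: kummer_coeffs_def)
qed

lemma kummer_coeffs_shift:
  assumes "c \<in> kummer_coeffs"
  shows "(\<lambda>k. c (k + n)) \<in> kummer_coeffs"
  unfolding kummer_coeffs_def using kummer_coeffsD[OF assms] by simp

lemma mahler_partial_sum:
  fixes c :: "nat \<Rightarrow> 'p::prime_card padic_int"
  assumes "c \<in> kummer_coeffs"
  shows "of_nat CARD('p) ^ N dvd mahler c s - (\<Sum>k<N. c k * padic_binomial s k)"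
  unfolding mahler_def using assms
  by (intro padic_series_converges) (simp add: kummer_coeffs_def)

lemma mahler_cong_coeff_0:
  fixes c :: "nat \<Rightarrow> 'p::prime_card padic_int"
  shows "c \<in> kummer_coeffs \<Longrightarrow> of_nat CARD('p) dvd mahler c s - c 0"
  using mahler_partial_sum[of c 1 s] by simp

lemma mahler_0:
  assumes "c \<in> kummer_coeffs"
  shows "mahler c 0 = c 0"
proof (rule padic_eqI)
  fix N
  have "(\<Sum>k<Suc N. c k * padic_binomial 0 k) = c 0"
    unfolding sum.lessThan_Suc_shift by simp
  then have "of_nat CARD('a) ^ Suc N dvd mahler c 0 - c 0"
    using mahler_partial_sum[OF assms, of "Suc N" 0] by simp
  then show "of_nat CARD('a) ^ N dvd mahler c 0 - c 0"
    by (rule dvd_trans[rotated]) (simp add: le_imp_power_dvd)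
qed

text \<open>By Pascal's rule this is an exact identity between partial sums, with one term fewer in
  the last series; the tails vanish modulo every power of p.\<close>

lemma mahler_plus_1:
  assumes c: "c \<in> kummer_coeffs"
  shows "mahler c (s + 1) = mahler c s + mahler (\<lambda>k. c (Suc k)) s"
proof (rule padic_eqI)
  fix N
  let ?S = "\<lambda>c s N. \<Sum>k<N. c k * padic_binomial s k"
  let ?d = "\<lambda>k. c (Suc k)"
  have d: "?d \<in> kummer_coeffs" using kummer_coeffs_shift[OF c, of 1] by simp
  have S: "?S c (s + 1) (Suc N) = ?S c s (Suc N) + ?S ?d s N"
    unfolding sum.lessThan_Suc_shift
    by (simp add: padic_binomial_Suc_Suc distrib_left sum.distrib)
  have "of_nat CARD('a) ^ N dvd mahler c t - ?S c t (Suc N)" for t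
    by (rule dvd_trans[OF _ mahler_partial_sum[OF c]]) (simp add: le_imp_power_dvd)
  note dvd_diff[OF dvd_diff[OF this[of "s + 1"] this[of s]] mahler_partial_sum[OF d, of N s]]
  then show "of_nat CARD('a) ^ N dvd mahler c (s + 1) - (mahler c s + mahler ?d s)"
    unfolding S by (simp add: algebra_simps)
qed

lemma fdiff_mahler:
  assumes c: "c \<in> kummer_coeffs"
  shows "fdiff n (mahler c) s = mahler (\<lambda>k. c (k + n)) s"
proof (induction n arbitrary: s)
  case (Suc n)
  show ?case
    unfolding fdiff_Suc Suc.IH mahler_plus_1[OF kummer_coeffs_shift[OF c]] by simp
qed simp

lemma mahler_in_kummer_space:
  fixes c :: "nat \<Rightarrow> 'p::prime_card padic_int"
  assumes c: "c \<in> kummer_coeffs"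
  shows "mahler c \<in> kummer_space"
  unfolding kummer_space_def
proof (intro CollectI allI)
  fix s n
  have "of_nat CARD('p) ^ n dvd c (k + n)" for k
    by (rule kummer_coeffsD[OF c]) simp
  then have "of_nat CARD('p) ^ n dvd (\<Sum>k<n. c (k + n) * padic_binomial s k)"
    by (intro dvd_sum dvd_mult2)
  from dvd_add[OF mahler_partial_sum[OF kummer_coeffs_shift[OF c], of n n s] this]
  show "of_nat CARD('p) ^ n dvd fdiff n (mahler c) s"
    unfolding fdiff_mahler[OF c] by simp
qed

lemma continuous_mahler:
  fixes c :: "nat \<Rightarrow> 'p::prime_card padic_int"
  assumes c: "c \<in> kummer_coeffs"
  shows "continuous_on UNIV (mahler c)"
proof (rule continuous_padicI)
  fix n
  let ?P = "of_nat CARD('p) :: 'p padic_int"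
  obtain v where v: "\<And>k n s t. ?P ^ (v k + n) dvd s - t \<Longrightarrow>
      ?P ^ n dvd padic_binomial s k - padic_binomial t k"
    using padic_binomial_cong[where 'p='p] by metis
  \<comment> \<open>Modulo p^n only the terms with \<open>k < n\<close> count; \<open>V\<close>
    bounds the precision lost in all their binomial coefficients at once.\<close>
  define V where "V = (\<Sum>k<n. v k)"
  have "?P ^ n dvd mahler c s - mahler c t" if st: "?P ^ (V + n) dvd s - t" for s t
  proof -
    have "?P ^ n dvd padic_binomial s k - padic_binomial t k" if "k < n" for k
    proof (rule v)
      have "v k \<le> V" unfolding V_def using that by (intro member_le_sum) auto
      then show "?P ^ (v k + n) dvd s - t"
        by (intro dvd_trans[OF le_imp_power_dvd st]) simp
    qed
    then have "?P ^ n dvd (\<Sum>k<n. c k * (padic_binomial s k - padic_binomial t k))"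
      by (intro dvd_sum dvd_mult) auto
    from dvd_add[OF dvd_diff[OF mahler_partial_sum[OF c, of n s] mahler_partial_sum[OF c, of n t]] this]
    show ?thesis by (simp add: algebra_simps sum_subtractf)
  qed
  then show "\<exists>m. \<forall>x y. ?P ^ m dvd x - y \<longrightarrow> ?P ^ n dvd mahler c x - mahler c y" by blast
qed

section \<open>The powers u^s and linear combinations of them\<close>

lemma padic_pow_eq_mahler: "padic_pow u = mahler (\<lambda>k. (u - 1) ^ k)"
  by (rule ext) (simp add: padic_pow_def mahler_def)

lemma power_in_kummer_coeffs:
  fixes x :: "'p::prime_card padic_int"
  shows "of_nat CARD('p) dvd x \<Longrightarrow> (\<lambda>k. x ^ k) \<in> kummer_coeffs"
  by (simp add: kummer_coeffs_def dvd_power_same)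

lemma padic_pow_0:
  fixes u :: "'p::prime_card padic_int"
  assumes "of_nat CARD('p) dvd u - 1"
  shows "padic_pow u 0 = 1"
  unfolding padic_pow_eq_mahler by (subst mahler_0[OF power_in_kummer_coeffs[OF assms]]) simp

lemma padic_pow_1:
  fixes u :: "'p::prime_card padic_int"
  assumes "of_nat CARD('p) dvd u - 1"
  shows "padic_pow u 1 = u"
proof -
  note c = power_in_kummer_coeffs[OF assms]
  show ?thesis
    unfolding padic_pow_eq_mahler
    using mahler_plus_1[OF c, of 0] mahler_0[OF c] mahler_0[OF kummer_coeffs_shift[OF c, of 1]] by simp
qed

lemma kummer_space_linear_combination:
  fixes f :: "'a \<Rightarrow> 'p::prime_card padic_int \<Rightarrow> 'p padic_int"
  assumes "\<And>a. a \<in> A \<Longrightarrow> f a \<in> kummer_space"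
  shows "(\<lambda>s. \<Sum>a\<in>A. w a * f a s) \<in> kummer_space"
  unfolding kummer_space_def
proof (intro CollectI allI)
  fix s n
  have "fdiff n (\<lambda>s. \<Sum>a\<in>A. w a * f a s) s = (\<Sum>a\<in>A. w a * fdiff n (f a) s)"
    unfolding fdiff_def sum_distrib_left by (subst sum.swap) (simp add: mult_ac)
  then show "of_nat CARD('p) ^ n dvd fdiff n (\<lambda>s. \<Sum>a\<in>A. w a * f a s) s"
    using assms by (auto simp: kummer_space_def intro!: dvd_sum dvd_mult)
qed

section \<open>The \<open>p\<close>-adic valuation of rational numbers\<close>

text \<open>This encodes v_p(x) >= k, with infinite valuation at 0. Since \<open>a\<close> may
  itself be divisible by p, sums and products need no reduced fractions.\<close>

definition pval_ge :: "nat \<Rightarrow> int \<Rightarrow> rat \<Rightarrow> bool" where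
  "pval_ge p k x \<longleftrightarrow>
     (\<exists>a b. \<not> int p dvd b \<and> x = of_nat p powi k * of_int a / of_int b)"

lemma pval_geI:
  "\<not> int p dvd b \<Longrightarrow> x = of_nat p powi k * of_int a / of_int b \<Longrightarrow> pval_ge p k x"
  unfolding pval_ge_def by blast

lemma pval_ge_0 [simp]: "prime p \<Longrightarrow> pval_ge p k 0"
  by (rule pval_geI[of p 1 _ _ 0]) (auto dest: prime_gt_1_nat)

lemma pval_ge_add:
  assumes p: "prime p" and "pval_ge p k x" "pval_ge p k y"
  shows "pval_ge p k (x + y)"
proof -
  obtain a b c d where ab: "\<not> int p dvd b" "x = of_nat p powi k * of_int a / of_int b"
    and cd: "\<not> int p dvd d" "y = of_nat p powi k * of_int c / of_int d"
    using assms unfolding pval_ge_def by metis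
  have nz: "b \<noteq> 0" "d \<noteq> 0" using ab cd by auto
  have "\<not> int p dvd b * d"
    using ab(1) cd(1) p by (simp add: prime_dvd_mult_iff)
  moreover have "x + y = of_nat p powi k * of_int (a * d + c * b) / of_int (b * d)"
    using nz by (simp add: ab cd field_simps)
  ultimately show ?thesis by (rule pval_geI)
qed

lemma pval_ge_mult:
  assumes p: "prime p" and "pval_ge p j x" "pval_ge p k y"
  shows "pval_ge p (j + k) (x * y)"
proof -
  obtain a b c d where ab: "\<not> int p dvd b" "x = of_nat p powi j * of_int a / of_int b"
    and cd: "\<not> int p dvd d" "y = of_nat p powi k * of_int c / of_int d"
    using assms unfolding pval_ge_def by metis
  have "\<not> int p dvd b * d"
    using ab(1) cd(1) p by (simp add: prime_dvd_mult_iff)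
  moreover have "x * y = of_nat p powi (j + k) * of_int (a * c) / of_int (b * d)"
    using p by (simp add: ab cd power_int_add prime_gt_0_nat)
  ultimately show ?thesis by (rule pval_geI)
qed

lemma pval_ge_p_power: "prime p \<Longrightarrow> pval_ge p (int k) (of_nat p ^ k)"
  by (rule pval_geI[of p 1 _ _ 1]) (auto dest: prime_gt_1_nat)

lemma pval_ge_of_int: "prime p \<Longrightarrow> pval_ge p 0 (of_int m)"
  by (rule pval_geI[of p 1 _ _ m]) (auto dest: prime_gt_1_nat)

lemma pval_ge_of_nat: "prime p \<Longrightarrow> pval_ge p 0 (of_nat m)"
  using pval_ge_of_int[of p "int m"] by simp

lemma pval_ge_of_int_dvd:
  assumes "prime p" "int p ^ k dvd m"
  shows "pval_ge p (int k) (of_int m)"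
proof -
  obtain a where "m = int p ^ k * a" using assms(2) by auto
  then show ?thesis using pval_ge_mult[OF assms(1) pval_ge_p_power[OF assms(1)] pval_ge_of_int[OF assms(1)]]
    by (metis add_0_right of_int_mult of_int_of_nat_eq of_int_power)
qed

lemma pval_ge_minus_iff [simp]: "pval_ge p k (- x) \<longleftrightarrow> pval_ge p k x"
proof -
  have "pval_ge p k (- x)" if "pval_ge p k x" for x
    using that unfolding pval_ge_def
    by (metis minus_divide_left mult_minus_right of_int_minus)
  from this[of x] this[of "-x"] show ?thesis by auto
qed

lemma pval_ge_diff:
  "prime p \<Longrightarrow> pval_ge p k x \<Longrightarrow> pval_ge p k y \<Longrightarrow> pval_ge p k (x - y)"
  using pval_ge_add[of p k x "- y"] by simp

lemma pval_ge_sum: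
  "prime p \<Longrightarrow> (\<And>i. i \<in> A \<Longrightarrow> pval_ge p k (f i)) \<Longrightarrow> pval_ge p k (sum f A)"
  by (induction A rule: infinite_finite_induct) (auto intro: pval_ge_add)

lemma pval_ge_mono:
  assumes "prime p" "pval_ge p k x" "j \<le> k"
  shows "pval_ge p j x"
proof -
  have "of_nat p powi (k - j) = (of_nat p ^ nat (k - j) :: rat)"
    using assms(3) by (simp add: power_int_def)
  then have "pval_ge p 0 (of_nat p powi (k - j))"
    using pval_ge_of_nat[OF assms(1), of "p ^ nat (k - j)"] by simp
  from pval_ge_mult[OF assms(1) assms(2) this]
  have "pval_ge p k (x * of_nat p powi (k - j))" by simp
  moreover obtain a b where "\<not> int p dvd b" "x = of_nat p powi k * of_int a / of_int b"
    using assms(2) unfolding pval_ge_def by blast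
  moreover have "(of_nat p powi k :: rat) = of_nat p powi j * of_nat p powi (k - j)"
    using assms(1) by (simp add: prime_gt_0_nat flip: power_int_add)
  moreover have "of_nat p powi (k - j) = (of_int (int p ^ nat (k - j)) :: rat)"
    using assms(3) by (simp add: power_int_def)
  ultimately show ?thesis
    by (intro pval_geI[of p b _ _ "int p ^ nat (k - j) * a"]) simp_all
qed

lemma pval_ge_cong:
  "prime p \<Longrightarrow> pval_ge p k (x - y) \<Longrightarrow> pval_ge p k x \<longleftrightarrow> pval_ge p k y"
  using pval_ge_add[of p k "x - y" y] pval_ge_diff[of p k x "x - y"] by auto

lemma pval_ge_inverse_unit:
  "\<not> int p dvd b \<Longrightarrow> pval_ge p 0 (1 / of_int b)"
  by (rule pval_geI[of p b _ _ 1]) auto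

lemma pval_ge_mult_unit_iff:
  assumes "prime p" "\<not> int p dvd b"
  shows "pval_ge p k (of_int b * x) \<longleftrightarrow> pval_ge p k x"
proof
  assume "pval_ge p k (of_int b * x)"
  from pval_ge_mult[OF assms(1) pval_ge_inverse_unit[OF assms(2)] this] assms(2)
  show "pval_ge p k x" by (cases "b = 0") auto
next
  assume "pval_ge p k x"
  from pval_ge_mult[OF assms(1) pval_ge_of_int[OF assms(1), of b] this]
  show "pval_ge p k (of_int b * x)" by simp
qed

text \<open>A power of p dividing \<open>n\<close> is at most \<open>n\<close>, so its exponent is
  at most \<open>m\<close>.\<close>

lemma pval_ge_inverse_of_nat:
  assumes p: "prime p" and n: "0 < n" "n < p ^ Suc m"
  shows "pval_ge p (- int m) (1 / of_nat n)"
proof -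
  define v where "v = multiplicity p n"
  have "n \<noteq> 0" "\<not> is_unit p" using n p by (auto dest: prime_gt_1_nat)
  then obtain q where v: "n = q * p ^ v" "\<not> p dvd q"
    unfolding v_def by (metis multiplicity_decompose' mult.commute)
  have "p ^ v < p ^ Suc m"
    using n dvd_imp_le[of "p ^ v" n] unfolding v(1) by (meson dvd_triv_right le_less_trans)
  then have vm: "v \<le> m" using p by (metis less_Suc_eq_le power_less_imp_less_exp prime_gt_1_nat)
  have "\<not> int p dvd int q" using v by simp
  moreover have "1 / of_nat n = (of_nat p powi (- int v) * of_int 1 / of_int (int q) :: rat)"
    by (simp add: v power_int_minus field_simps)
  ultimately have "pval_ge p (- int v) (1 / of_nat n)" by (rule pval_geI)
  then show ?thesis by (rule pval_ge_mono[OF p]) (use vm in simp)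
qed

lemma pval_ge_exists:
  assumes p: "prime p"
  shows "\<exists>m. pval_ge p (- int m) x"
proof -
  obtain a b where ab: "x = of_int a / of_int b" "b > 0"
    using quotient_of_div[of x "fst (quotient_of x)" "snd (quotient_of x)"] quotient_of_denom_pos'[of x] by simp
  \<comment> \<open>A crude exponent is enough, as only its existence matters: the denominator
    \<open>b\<close> lies below p^(b+1).\<close>
  have "nat b < 2 ^ Suc (nat b)" using less_exp[of "Suc (nat b)"] by (rule Suc_lessD)
  also have "\<dots> \<le> p ^ Suc (nat b)" by (intro power_mono prime_ge_2_nat p) simp
  finally have "nat b < p ^ Suc (nat b)" .
  with pval_ge_inverse_of_nat[OF p, of "nat b" "nat b"] ab
  have "pval_ge p (- int (nat b)) (1 / of_int b)" by simp
  from pval_ge_mult[OF p pval_ge_of_int[OF p, of a] this]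
  have "pval_ge p (- int (nat b)) x" using ab by simp
  then show ?thesis by blast
qed

section \<open>Bernoulli numbers and power sums\<close>

text \<open>The division in \<open>bernoulli\<close> is exact because e^X - 1 has order 1.\<close>

lemma bernoulli_gf: "fps_X / (fps_exp 1 - 1) * (fps_exp 1 - 1) = (fps_X :: rat fps)"
proof (rule dvd_div_mult_self)
  have "subdegree (fps_exp 1 - 1 :: rat fps) = 1"
    by (rule subdegreeI) auto
  then show "fps_exp 1 - 1 dvd (fps_X :: rat fps)"
    by (subst fps_dvd_iff) auto
qed

text \<open>Compare coefficients of X^n in the sum of e^(aX) over a < m, which factors as ((e^(mX) -
  1)/X) times (X/(e^X - 1)).\<close>

lemma faulhaber:
  "(\<Sum>a<m. of_nat a ^ n :: rat) =
    (\<Sum>k=0..n. of_nat (n choose k) * bernoulli (n - k) * of_nat m ^ Suc k / of_nat (Suc k))"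
proof -
  define F :: "rat fps" where "F = fps_X / (fps_exp 1 - 1)"
  define H :: "rat fps" where "H = Abs_fps (\<lambda>k. of_nat m ^ Suc k / fact (Suc k))"
  define S :: "rat fps" where "S = (\<Sum>a<m. fps_exp (of_nat a))"
  have XH: "fps_X * H = fps_exp (of_nat m) - 1"
    by (rule fps_ext) (auto simp: H_def fps_X_mult_nth gr0_conv_Suc simp del: of_nat_Suc fact_Suc)
  have "S * (fps_exp 1 - 1) = fps_exp (of_nat m) - 1"
    unfolding S_def
    by (induction m) (simp_all add: algebra_simps fps_exp_add_mult)
  then have "S * (F * (fps_exp 1 - 1)) = F * (fps_X * H)"
    unfolding XH by (simp only: mult.left_commute[of S])
  then have "fps_X * S = fps_X * (H * F)"
    using bernoulli_gf by (simp only: F_def mult_ac)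
  then have "S = H * F" using mult_cancel_left[of fps_X S "H * F"] by simp
  then have "fps_nth S n = fps_nth (H * F) n" by simp
  then have "(\<Sum>a<m. of_nat a ^ n) / fact n =
      (\<Sum>k=0..n. of_nat m ^ Suc k / fact (Suc k) * fps_nth F (n - k))"
    by (simp add: S_def fps_sum_nth fps_mult_nth H_def sum_divide_distrib del: power_Suc fact_Suc)
  then have "(\<Sum>a<m. of_nat a ^ n) =
      (\<Sum>k=0..n. fact n * (of_nat m ^ Suc k / fact (Suc k) * fps_nth F (n - k)))"
    by (simp add: field_simps sum_distrib_left del: power_Suc fact_Suc)
  also have "\<dots> = (\<Sum>k=0..n. of_nat (n choose k) * bernoulli (n - k) * of_nat m ^ Suc k / of_nat (Suc k))"
    by (intro sum.cong refl) (simp add: bernoulli_def F_def binomial_fact field_simps del: power_Suc of_nat_Suc)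
  finally show ?thesis .
qed

text \<open>For m = 1 the power sum is 0^n, and Faulhaber's formula becomes the recursion for
  Bernoulli numbers.\<close>

lemma bernoulli_0: "bernoulli 0 = 1" and bernoulli_1: "bernoulli 1 = - 1/2"
  and bernoulli_2: "bernoulli 2 = 1/6"
proof -
  show B0: "bernoulli 0 = 1" using faulhaber[of 0 "Suc 0"] by simp
  show B1: "bernoulli 1 = - 1/2" using faulhaber[of "Suc 0" "Suc 0"] B0 by simp
  show "bernoulli 2 = 1/6"
    using faulhaber[of 2 "Suc 0"] B0 B1 by (simp add: numeral_2_eq_2)
qed

text \<open>\<open>F(-X) = F(X) + X\<close> for \<open>F(X) = X/(e\<^sup>X - 1)\<close>.\<close>

lemma bernoulli_odd:
  assumes "odd n" "1 < n"
  shows "bernoulli n = 0"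
proof -
  define F :: "rat fps" where "F = fps_X / (fps_exp 1 - 1)"
  define G :: "rat fps" where "G = Abs_fps (\<lambda>n. (-1) ^ n * fps_nth F n)"
  have F: "F * (fps_exp 1 - 1) = fps_X" unfolding F_def by (rule bernoulli_gf)
  have "G * (fps_exp (-1) - 1) = - fps_X"
  proof (rule fps_ext)
    fix n
    have "fps_nth (G * (fps_exp (-1) - 1)) n = (-1) ^ n * fps_nth (F * (fps_exp 1 - 1)) n"
      unfolding fps_mult_nth sum_distrib_left
    proof (rule sum.cong[OF refl])
      fix i assume "i \<in> {0..n}"
      then have pw: "(-1 :: rat) ^ n = (-1) ^ i * (-1) ^ (n - i)" by (simp flip: power_add)
      have ex: "fps_nth (fps_exp (- 1 :: rat) - 1) j = (-1) ^ j * fps_nth (fps_exp 1 - 1) j" for j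
        by (cases j) auto
      show "fps_nth G i * fps_nth (fps_exp (- 1) - 1) (n - i) =
          (- 1) ^ n * (fps_nth F i * fps_nth (fps_exp 1 - 1) (n - i))"
        by (simp only: G_def fps_nth_Abs_fps pw ex mult_ac)
    qed
    then show "fps_nth (G * (fps_exp (-1) - 1)) n = fps_nth (- fps_X) n"
      by (simp add: F fps_X_def)
  qed
  \<comment> \<open>\<open>G\<close> is F(-X). Multiplication by e^X turns e^(-X) - 1 into 1 - e^X,
    so that \<open>F\<close> and \<open>G\<close> can be compared.\<close>
  then have "G * (fps_exp (-1) - 1) * fps_exp 1 = - fps_X * fps_exp 1" by simp
  moreover have "fps_exp (-1) * fps_exp 1 = (1 :: rat fps)"
    by (simp flip: fps_exp_add_mult)
  ultimately have "G * (fps_exp 1 - 1) = fps_X * fps_exp 1"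
    by (simp add: algebra_simps)
  also have "\<dots> = (F + fps_X) * (fps_exp 1 - 1)"
    using F by (simp add: algebra_simps)
  finally have "G * (fps_exp 1 - 1) = (F + fps_X) * (fps_exp 1 - 1)" .
  moreover have "fps_exp 1 - 1 \<noteq> (0 :: rat fps)"
    using F by auto
  ultimately have "G = F + fps_X" by (simp only: mult_cancel_right) auto
  then have "fps_nth G n = fps_nth (F + fps_X) n" by simp
  then have "fps_nth F n = 0" using assms by (simp add: G_def)
  then show ?thesis by (simp add: bernoulli_def F_def)
qed

section \<open>Power sums over a < p and Bernoulli numbers modulo powers of p\<close>

text \<open>From k + 1 < 3^k <= p^k. Hence p^(k+1)/(k+1) in Faulhaber's formula has valuation at
  least 2.\<close>

lemma pval_ge_inverse_Suc:
  assumes p: "prime p" "2 < p" and "0 < k"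
  shows "pval_ge p (1 - int k) (1 / of_nat (Suc k))"
proof -
  have "Suc k < 3 ^ k" using \<open>0 < k\<close> by (induction k rule: nat_induct_non_zero) auto
  also have "\<dots> \<le> p ^ k" using p by (intro power_mono) auto
  finally have "Suc k < p ^ Suc (k - 1)" using \<open>0 < k\<close> by simp
  from pval_ge_inverse_of_nat[OF p(1) _ this] \<open>0 < k\<close> show ?thesis by (simp add: of_nat_diff)
qed

text \<open>From p >= 5 and k + 1 < 5^(k-2). Hence p^(k+1)/(k+1) has valuation at least 4, leaving 3
  after a factor p in a Bernoulli denominator.\<close>

lemma pval_ge_inverse_Suc':
  assumes p: "prime p" "3 < p" and "2 < k"
  shows "pval_ge p (3 - int k) (1 / of_nat (Suc k))"
proof -
  have p5: "5 \<le> p" using p by (cases "p = 4") auto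
  have "Suc (j + 3) < 5 ^ Suc j" for j by (induction j) auto
  from this[of "k - 3"] have "Suc k < 5 ^ (k - 2)" using \<open>2 < k\<close> by (simp add: Suc_diff_Suc numeral_3_eq_3 numeral_2_eq_2)
  also have "\<dots> \<le> p ^ (k - 2)" using p5 by (intro power_mono) auto
  finally have "Suc k < p ^ Suc (k - 3)" using \<open>2 < k\<close> by (simp add: Suc_diff_Suc numeral_3_eq_3 numeral_2_eq_2)
  from pval_ge_inverse_of_nat[OF p(1) _ this] \<open>2 < k\<close> show ?thesis by (simp add: of_nat_diff)
qed

text \<open>The term k = 0 of Faulhaber's formula is m B_n. The reciprocal is kept as a factor to
  fit \<open>pval_ge_mult4\<close>.\<close>

lemma faulhaber_minus_leading:
  "(\<Sum>a<m. of_nat a ^ n) - of_nat m * bernoulli n =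
    (\<Sum>k=1..n. of_nat (n choose k) * bernoulli (n - k) * of_nat m ^ Suc k * (1 / of_nat (Suc k)))"
  unfolding faulhaber by (simp add: sum.atLeast_Suc_atMost[of 0 n] del: of_nat_Suc)

lemma pval_ge_mult4:
  assumes "prime p" "pval_ge p i x" "pval_ge p j y" "pval_ge p k z" "m \<le> i + j + k"
  shows "pval_ge p m (of_nat n * x * y * z)"
proof (rule pval_ge_mono)
  show "pval_ge p (0 + i + j + k) (of_nat n * x * y * z)"
    using assms by (intro pval_ge_mult pval_ge_of_nat)
qed (use assms in auto)

text \<open>A weak form of von Staudt's theorem by induction: for k >= 1 the denominator of B_(n-k)
  is outweighed by p^(k+1)/(k+1), so p B_n differs from an integer by a p-integral number.\<close>

lemma pval_ge_bernoulli:
  assumes p: "prime p" "2 < p"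
  shows "pval_ge p (-1) (bernoulli n)"
proof (induction n rule: less_induct)
  case (less n)
  have "pval_ge p 0 (of_nat (n choose k) * bernoulli (n - k) * of_nat p ^ Suc k * (1 / of_nat (Suc k)))"
    if "k \<in> {1..n}" for k
    by (rule pval_ge_mult4[OF p(1) less pval_ge_p_power[OF p(1)] pval_ge_inverse_Suc[OF p]]) (use that in auto)
  then have "pval_ge p 0 ((\<Sum>a<p. of_nat a ^ n) - of_nat p * bernoulli n)"
    unfolding faulhaber_minus_leading by (intro pval_ge_sum p)
  moreover have "pval_ge p 0 (\<Sum>a<p. of_nat a ^ n)"
    using pval_ge_of_nat[OF p(1), of "\<Sum>a<p. a ^ n"] by simp
  ultimately have "pval_ge p 0 (of_nat p * bernoulli n)"
    by (simp add: pval_ge_cong[OF p(1)])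
  moreover have "pval_ge p (-1) (1 / of_nat p)"
    using pval_ge_inverse_of_nat[OF p(1), of p 1] p by simp
  ultimately have "pval_ge p (-1 + 0) (1 / of_nat p * (of_nat p * bernoulli n))"
    by (intro pval_ge_mult[OF p(1)])
  then show ?case using p by simp
qed

lemma pval_ge_power_sum_minus_bernoulli_1:
  assumes p: "prime p" "2 < p"
  shows "pval_ge p 1 ((\<Sum>a<p. of_nat a ^ n) - of_nat p * bernoulli n)"
  unfolding faulhaber_minus_leading
proof (rule pval_ge_sum[OF p(1)])
  fix k assume "k \<in> {1..n}"
  then show "pval_ge p 1 (of_nat (n choose k) * bernoulli (n - k) * of_nat p ^ Suc k * (1 / of_nat (Suc k)))"
    by (intro pval_ge_mult4[OF p(1) pval_ge_bernoulli[OF p] pval_ge_p_power[OF p(1)] pval_ge_inverse_Suc[OF p]]) auto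
qed

text \<open>A primitive root qualifies, since its order p - 1 does not divide
  \<open>n\<close>.\<close>

lemma ex_power_not_cong_1:
  assumes p: "prime p" and n: "\<not> (p - 1) dvd n"
  obtains c where "\<not> p dvd c" "\<not> int p dvd int (c ^ n) - 1"
proof -
  obtain g where g: "residue_primroot p g"
    using prime_primitive_root_exists[OF prime_gt_1_nat[OF p]] p by auto
  then have cop: "coprime p g" and ord: "ord p g = p - 1"
    using p by (auto simp: residue_primroot_def totient_prime)
  have "\<not> p dvd g" using cop p by (auto dest: coprime_common_divisor[of p g p])
  moreover have "\<not> [g ^ n = 1] (mod p)"
    using n ord ord_divides[of g n p] by simp
  then have "\<not> int p dvd int (g ^ n) - 1"
    by (metis cong_iff_dvd_diff cong_int_iff of_nat_1)
  ultimately show ?thesis by (rule that)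
qed

text \<open>An injective self-map of a finite set is bijective. The general \<open>A\<close> covers
  both all residues modulo p and the units modulo p^N.\<close>

lemma bij_betw_mult_mod:
  fixes c m :: nat
  assumes c: "coprime c m" and A: "A \<subseteq> {..<m}" "\<And>a. a \<in> A \<Longrightarrow> c * a mod m \<in> A"
  shows "bij_betw (\<lambda>a. c * a mod m) A A"
proof -
  have "inj_on (\<lambda>a. c * a mod m) A"
  proof (rule inj_onI)
    fix a b assume "a \<in> A" "b \<in> A" "c * a mod m = c * b mod m"
    then have "[a = b] (mod m)" using c by (metis cong_def cong_mult_lcancel_nat)
    then show "a = b" using A(1) \<open>a \<in> A\<close> \<open>b \<in> A\<close> by (auto simp: cong_def subset_eq)
  qed
  moreover have "finite A" using A(1) by (rule finite_subset) simp
  ultimately show ?thesis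
    unfolding bij_betw_def using A(2) by (intro conjI endo_inj_surj) auto
qed

text \<open>Multiplication by \<open>c\<close> permutes the residues, so the sum is congruent to c^n
  times itself, while c^n - 1 is prime to p.\<close>

lemma prime_dvd_power_sum:
  assumes p: "prime p" and n: "\<not> (p - 1) dvd n"
  shows "int p dvd (\<Sum>a<p. int a ^ n)"
proof -
  obtain c where c: "\<not> p dvd c" "\<not> int p dvd int (c ^ n) - 1"
    using ex_power_not_cong_1[OF p n] .
  have cop: "coprime c p" using prime_imp_coprime[OF p c(1)] by (simp add: coprime_commute)
  have "bij_betw (\<lambda>a. c * a mod p) {..<p} {..<p}"
    using p by (intro bij_betw_mult_mod cop) (auto dest: prime_gt_0_nat)
  then have "(\<Sum>a<p. int a ^ n) = (\<Sum>a<p. int (c * a mod p) ^ n)"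
    by (rule sum.reindex_bij_betw[symmetric])
  also have "[\<dots> = (\<Sum>a<p. int (c * a) ^ n)] (mod int p)"
    by (intro cong_sum cong_pow) (simp add: zmod_int)
  also have "(\<Sum>a<p. int (c * a) ^ n) = int (c ^ n) * (\<Sum>a<p. int a ^ n)"
    by (simp add: sum_distrib_left power_mult_distrib)
  finally have "int p dvd (\<Sum>a<p. int a ^ n) - int (c ^ n) * (\<Sum>a<p. int a ^ n)"
    by (simp only: cong_iff_dvd_diff)
  then have "int p dvd - ((\<Sum>a<p. int a ^ n) - int (c ^ n) * (\<Sum>a<p. int a ^ n))"
    by (simp only: dvd_minus_iff)
  then have "int p dvd (int (c ^ n) - 1) * (\<Sum>a<p. int a ^ n)"
    by (simp add: left_diff_distrib)
  then show ?thesis using c p by (simp add: prime_dvd_mult_iff)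
qed

text \<open>The power sum is divisible by p and congruent to p B_n modulo p, so p divides p
  B_n.\<close>

lemma pval_ge_bernoulli_0:
  assumes p: "prime p" "2 < p" and n: "\<not> (p - 1) dvd n"
  shows "pval_ge p 0 (bernoulli n)"
proof -
  have "pval_ge p 1 (\<Sum>a<p. of_nat a ^ n)"
    using pval_ge_of_int_dvd[OF p(1), of 1 "\<Sum>a<p. int a ^ n"] prime_dvd_power_sum[OF p(1) n] by simp
  then have "pval_ge p 1 (of_nat p * bernoulli n)"
    using pval_ge_power_sum_minus_bernoulli_1[OF p] pval_ge_cong[OF p(1)] by blast
  moreover have "pval_ge p (-1) (1 / of_nat p)"
    using pval_ge_inverse_of_nat[OF p(1), of p 1] p by simp
  ultimately have "pval_ge p (-1 + 1) (1 / of_nat p * (of_nat p * bernoulli n))"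
    by (intro pval_ge_mult[OF p(1)])
  then show ?thesis using p by simp
qed

text \<open>Valuations of the terms: for k = 1 the number B_(n-1) is p-integral by hypothesis,
  giving 2; for k = 2 the bound is -1 + 3, as 3 is prime to p; for k > 2 it is 3.\<close>

lemma pval_ge_power_sum_minus_bernoulli_2:
  assumes p: "prime p" "3 < p" and n: "\<not> (p - 1) dvd n - 1"
  shows "pval_ge p 2 ((\<Sum>a<p. of_nat a ^ n) - of_nat p * bernoulli n)"
  unfolding faulhaber_minus_leading
proof (rule pval_ge_sum[OF p(1)])
  fix k assume k: "k \<in> {1..n}"
  have p2: "2 < p" using p by simp
  note mult4 = pval_ge_mult4[OF p(1) _ pval_ge_p_power[OF p(1)]]
  consider "k = 1" | "k = 2" | "2 < k" using k by force
  then show "pval_ge p 2 (of_nat (n choose k) * bernoulli (n - k) * of_nat p ^ Suc k * (1 / of_nat (Suc k)))"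
  proof cases
    case 1
    show ?thesis
      by (rule mult4[OF pval_ge_bernoulli_0[OF p(1) p2] pval_ge_inverse_Suc[OF p(1) p2]])
        (use n 1 in auto)
  next
    case 2
    have "pval_ge p 0 (1 / of_nat (Suc k))"
      using pval_ge_inverse_of_nat[OF p(1), of 3 0] p 2 by simp
    then show ?thesis
      by (rule mult4[OF pval_ge_bernoulli[OF p(1) p2]]) (use 2 in auto)
  next
    case 3
    show ?thesis
      by (rule mult4[OF pval_ge_bernoulli[OF p(1) p2] pval_ge_inverse_Suc'[OF p]]) (use 3 in auto)
  qed
qed

text \<open>The term k = 1 vanishes, as n - 1 is odd and above 1; for k = 2 the number B_(n-2) is
  p-integral by hypothesis, giving 3; later terms have valuation at least 3.\<close>

lemma pval_ge_power_sum_minus_bernoulli_3: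
  assumes p: "prime p" "3 < p" and n: "even n" "2 < n" "\<not> (p - 1) dvd n - 2"
  shows "pval_ge p 3 ((\<Sum>a<p. of_nat a ^ n) - of_nat p * bernoulli n)"
  unfolding faulhaber_minus_leading
proof (rule pval_ge_sum[OF p(1)])
  fix k assume k: "k \<in> {1..n}"
  have p2: "2 < p" using p by simp
  note mult4 = pval_ge_mult4[OF p(1) _ pval_ge_p_power[OF p(1)]]
  consider "k = 1" | "k = 2" | "2 < k" using k by force
  then show "pval_ge p 3 (of_nat (n choose k) * bernoulli (n - k) * of_nat p ^ Suc k * (1 / of_nat (Suc k)))"
  proof cases
    case 1
    then show ?thesis using n p by (simp add: bernoulli_odd)
  next
    case 2
    have third: "pval_ge p 0 (1 / of_nat (Suc k))"
      using pval_ge_inverse_of_nat[OF p(1), of 3 0] p 2 by simp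
    show ?thesis
      by (rule mult4[OF pval_ge_bernoulli_0[OF p(1) p2] third]) (use 2 n in auto)
  next
    case 3
    show ?thesis
      by (rule mult4[OF pval_ge_bernoulli[OF p(1) p2] pval_ge_inverse_Suc'[OF p]]) (use 3 in auto)
  qed
qed

section \<open>Kummer congruences\<close>

text \<open>Each term k >= 1 of Faulhaber's formula contains p^(2N), and \<open>C\<close> bounds the
  finitely many remaining denominators independently of \<open>N\<close>. Thus B_n is the limit of
  the power sums divided by p^N.\<close>

lemma power_sum_approx:
  assumes p: "prime p"
  shows "\<exists>C. \<forall>N. pval_ge p (2 * int N - int C)
    ((\<Sum>a<p ^ N. of_nat a ^ n) - of_nat p ^ N * bernoulli n)"
proof -
  define x where "x k = bernoulli (n - k) * (1 / of_nat (Suc k))" for k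
  have "\<exists>m. \<forall>k. pval_ge p (- int (m k)) (x k)"
    by (intro choice allI pval_ge_exists p)
  then obtain m where m: "\<And>k. pval_ge p (- int (m k)) (x k)" by blast
  define C where "C = (\<Sum>k=1..n. m k)"
  have "pval_ge p (2 * int N - int C) ((\<Sum>a<p ^ N. of_nat a ^ n) - of_nat p ^ N * bernoulli n)" for N
  proof -
    have "pval_ge p (2 * int N - int C) (of_nat (n choose k) * bernoulli (n - k) *
        of_nat (p ^ N) ^ Suc k * (1 / of_nat (Suc k)))" if k: "k \<in> {1..n}" for k
    proof -
      have "m k \<le> C" unfolding C_def by (rule member_le_sum) (use k in auto)
      moreover have "2 * N \<le> N * Suc k" using k by (simp add: mult.commute)
      then have "2 * int N \<le> int (N * Suc k)" by linarith
      ultimately have "2 * int N - int C \<le> 0 + int (N * Suc k) + - int (m k)" by linarith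
      then have "pval_ge p (2 * int N - int C) (of_nat (n choose k) * 1 * of_nat p ^ (N * Suc k) * x k)"
        by (intro pval_ge_mult4[OF p _ pval_ge_p_power[OF p] m]) (use pval_ge_of_nat[OF p, of 1] in auto)
      moreover have "of_nat (n choose k) * 1 * of_nat p ^ (N * Suc k) * x k = of_nat (n choose k) *
          bernoulli (n - k) * of_nat (p ^ N) ^ Suc k * (1 / of_nat (Suc k))"
        unfolding x_def of_nat_power power_mult by (simp only: mult_ac mult_1_left)
      ultimately show ?thesis by simp
    qed
    then have "pval_ge p (2 * int N - int C) ((\<Sum>a<p ^ N. of_nat a ^ n) - of_nat (p ^ N) * bernoulli n)"
      unfolding faulhaber_minus_leading by (rule pval_ge_sum[OF p])
    then show ?thesis by simp
  qed
  then show ?thesis by blast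
qed

section \<open>Power sums over the units modulo p^N\<close>

definition units_below :: "nat \<Rightarrow> nat \<Rightarrow> nat set" where
  "units_below p N = {a. a < p ^ N \<and> \<not> p dvd a}"

text \<open>The multiples of p below p^N are p b with b < p^(N-1). Their removal is the source of
  the Euler factor 1 - p^(n-1).\<close>

lemma sum_units_below:
  assumes p: "prime p" and "0 < N"
  shows "(\<Sum>a\<in>units_below p N. of_nat a ^ n :: rat) =
    (\<Sum>a<p ^ N. of_nat a ^ n) - of_nat p ^ n * (\<Sum>a<p ^ (N - 1). of_nat a ^ n)"
proof -
  have pN: "p ^ N = p * p ^ (N - 1)" using \<open>0 < N\<close> by (cases N) auto
  have p0: "0 < p" using p by (rule prime_gt_0_nat)
  have split: "{..<p ^ N} = units_below p N \<union> (\<lambda>a. p * a) ` {..<p ^ (N - 1)}"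
  proof (intro equalityI subsetI)
    fix a assume a: "a \<in> {..<p ^ N}"
    show "a \<in> units_below p N \<union> (\<lambda>a. p * a) ` {..<p ^ (N - 1)}"
    proof (cases "p dvd a")
      case True
      then obtain b where "a = p * b" by (rule dvdE)
      with a p0 show ?thesis by (simp add: pN)
    qed (use a in \<open>simp add: units_below_def\<close>)
  qed (use p0 in \<open>auto simp: units_below_def pN\<close>)
  have "(\<Sum>a<p ^ N. of_nat a ^ n :: rat) =
      (\<Sum>a\<in>units_below p N. of_nat a ^ n) + (\<Sum>a\<in>(\<lambda>a. p * a) ` {..<p ^ (N - 1)}. of_nat a ^ n)"
    unfolding split by (rule sum.union_disjoint) (auto simp: units_below_def)
  also have "(\<Sum>a\<in>(\<lambda>a. p * a) ` {..<p ^ (N - 1)}. of_nat a ^ n :: rat) =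
      of_nat p ^ n * (\<Sum>a<p ^ (N - 1). of_nat a ^ n)"
    using p0 by (subst sum.reindex) (auto simp: inj_on_def sum_distrib_left power_mult_distrib)
  finally show ?thesis by simp
qed

lemma units_sum_approx:
  assumes p: "prime p" and n: "0 < n"
  shows "\<exists>C. \<forall>N>0. pval_ge p (2 * int N - int C)
    ((\<Sum>a\<in>units_below p N. of_nat a ^ n) - of_nat p ^ N * ((1 - of_nat p ^ (n - 1)) * bernoulli n))"
proof -
  obtain C where C: "\<And>N. pval_ge p (2 * int N - int C)
      ((\<Sum>a<p ^ N. of_nat a ^ n) - of_nat p ^ N * bernoulli n)"
    using power_sum_approx[OF p] by blast
  \<comment> \<open>The 2 pays for using the approximation at \<open>N - 1\<close> as well.\<close>
  have "pval_ge p (2 * int N - int (C + 2))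
      ((\<Sum>a\<in>units_below p N. of_nat a ^ n) - of_nat p ^ N * ((1 - of_nat p ^ (n - 1)) * bernoulli n))"
    if N: "0 < N" for N
  proof -
    let ?d = "\<lambda>N. (\<Sum>a<p ^ N. of_nat a ^ n) - of_nat p ^ N * bernoulli n"
    have "pval_ge p (0 + (2 * int (N - 1) - int C)) (of_nat (p ^ n) * ?d (N - 1))"
      by (intro pval_ge_mult[OF p pval_ge_of_nat[OF p] C])
    then have d1: "pval_ge p (2 * int N - int (C + 2)) (of_nat (p ^ n) * ?d (N - 1))"
      by (rule pval_ge_mono[OF p]) (use N in simp)
    have d2: "pval_ge p (2 * int N - int (C + 2)) (?d N)"
      by (rule pval_ge_mono[OF p C]) simp
    note pval_ge_diff[OF p d2 d1]
    moreover have "(of_nat p ^ N * of_nat p ^ (n - 1) :: rat) = of_nat p ^ n * of_nat p ^ (N - 1)"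
      using N n by (simp add: add.commute flip: power_add)
    then have "?d N - of_nat (p ^ n) * ?d (N - 1) = (\<Sum>a\<in>units_below p N. of_nat a ^ n) -
        of_nat p ^ N * ((1 - of_nat p ^ (n - 1)) * bernoulli n)"
      unfolding sum_units_below[OF p N] by (simp add: algebra_simps)
    ultimately show ?thesis by simp
  qed
  then show ?thesis by blast
qed

lemma power_add_expansion:
  fixes x y :: "'a::comm_ring_1"
  shows "y\<^sup>2 dvd (x + y) ^ n - x ^ n - of_nat n * x ^ (n - 1) * y"
proof (induction n)
  case (Suc n)
  have eq: "(x + y) ^ Suc n - x ^ Suc n - of_nat (Suc n) * x ^ (Suc n - 1) * y =
      (x + y) * ((x + y) ^ n - x ^ n - of_nat n * x ^ (n - 1) * y) + of_nat n * x ^ (n - 1) * y\<^sup>2"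
    by (cases n) (simp_all add: algebra_simps power2_eq_square)
  show ?case unfolding eq by (intro dvd_add dvd_mult Suc.IH) auto
qed simp

text \<open>The values \<open>(1 - p\<^sup>n\<^sup>-\<^sup>1) \<zeta>(1 - n)\<close>.\<close>

definition zeta_value :: "nat \<Rightarrow> nat \<Rightarrow> rat" where
  "zeta_value p n = - (1 - of_nat p ^ (n - 1)) * bernoulli n / of_nat n"

text \<open>The second-order remainders are divisible by p^(2N), and the n-th powers of the
  \<open>c * a mod p ^ N\<close> sum to the original power sum.\<close>

lemma units_sum_mult_mod:
  assumes p: "prime p" and c: "\<not> p dvd c" and N: "0 < N"
  shows "int (p ^ N) ^ 2 dvd (int (c ^ n) - 1) * (\<Sum>a\<in>units_below p N. int a ^ n) -
    int n * int (p ^ N) * (\<Sum>a\<in>units_below p N. int (c * a mod p ^ N) ^ (n - 1) * int (c * a div p ^ N))"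
proof -
  let ?U = "units_below p N"
  let ?b = "\<lambda>a. int (c * a mod p ^ N)" and ?y = "\<lambda>a. int (p ^ N) * int (c * a div p ^ N)"
  have bij: "bij_betw (\<lambda>a. c * a mod p ^ N) ?U ?U"
  proof (rule bij_betw_mult_mod)
    show "coprime c (p ^ N)"
      using prime_imp_coprime[OF p c] by (simp add: coprime_commute)
    show "?U \<subseteq> {..<p ^ N}" by (auto simp: units_below_def)
    fix a assume "a \<in> ?U"
    then have "\<not> p dvd c * a" using p c by (simp add: units_below_def prime_dvd_mult_iff)
    moreover have "p dvd p ^ N" using N by simp
    ultimately show "c * a mod p ^ N \<in> ?U"
      using p by (simp add: units_below_def dvd_mod_iff prime_gt_0_nat)
  qed
  have ca: "int (c * a) = ?b a + ?y a" for a
    by (simp only: mod_mult_div_eq flip: of_nat_mult of_nat_add)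
  have "int (p ^ N) ^ 2 dvd int (c * a) ^ n - ?b a ^ n - int n * ?b a ^ (n - 1) * ?y a" for a
    unfolding ca by (rule dvd_trans[OF _ power_add_expansion]) (simp add: power_mult_distrib)
  then have "int (p ^ N) ^ 2 dvd (\<Sum>a\<in>?U. int (c * a) ^ n - ?b a ^ n - int n * ?b a ^ (n - 1) * ?y a)"
    by (intro dvd_sum) auto
  also have "(\<Sum>a\<in>?U. int (c * a) ^ n - ?b a ^ n - int n * ?b a ^ (n - 1) * ?y a) =
      (\<Sum>a\<in>?U. int (c * a) ^ n) - (\<Sum>a\<in>?U. ?b a ^ n) - (\<Sum>a\<in>?U. int n * ?b a ^ (n - 1) * ?y a)"
    by (simp only: sum_subtractf)
  also have "(\<Sum>a\<in>?U. ?b a ^ n) = (\<Sum>a\<in>?U. int a ^ n)"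
    using sum.reindex_bij_betw[OF bij, of "\<lambda>a. int a ^ n"] by simp
  also have "(\<Sum>a\<in>?U. int (c * a) ^ n) = int (c ^ n) * (\<Sum>a\<in>?U. int a ^ n)"
    by (simp add: sum_distrib_left power_mult_distrib)
  also have "(\<Sum>a\<in>?U. int n * ?b a ^ (n - 1) * ?y a) =
      int n * int (p ^ N) * (\<Sum>a\<in>?U. ?b a ^ (n - 1) * int (c * a div p ^ N))"
    unfolding sum_distrib_left by (intro sum.cong refl) (simp only: mult_ac)
  finally show ?thesis by (simp only: left_diff_distrib mult_1_left)
qed

text \<open>
  Writing \<open>c a = b + p\<^sup>N e\<close> with \<open>0 \<le> b < p\<^sup>N\<close>, the map \<open>a \<mapsto> b\<close> permutes the units modulo \<open>p\<^sup>N\<close>.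
  Expanding \<open>(b + p\<^sup>N e)\<^sup>n\<close> to first order turns a power sum divided by \<open>n p\<^sup>N\<close>
  into a sum in which \<open>n\<close> only occurs as an exponent.
\<close>

lemma zeta_value_approx:
  assumes p: "prime p" and n: "0 < n"
  shows "\<exists>C. \<forall>N>0. \<forall>c d. \<not> p dvd c \<longrightarrow> int (p ^ N) dvd int (c ^ n) - d \<longrightarrow>
    pval_ge p (int N - int C) (of_int (d - 1) * zeta_value p n +
      of_int (\<Sum>a\<in>units_below p N. int (c * a mod p ^ N) ^ (n - 1) * int (c * a div p ^ N)))"
proof -
  define G where "G = (1 - of_nat p ^ (n - 1)) * bernoulli n"
  obtain C1 where C1: "\<And>N. 0 < N \<Longrightarrow> pval_ge p (2 * int N - int C1)
      ((\<Sum>a\<in>units_below p N. of_nat a ^ n) - of_nat p ^ N * G)"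
    using units_sum_approx[OF p n] unfolding G_def by blast
  obtain C2 where C2: "pval_ge p (- int C2) G" using pval_ge_exists[OF p] by blast
  obtain C3 where C3: "pval_ge p (- int C3) (1 / of_nat n)" using pval_ge_exists[OF p] by blast
  have "pval_ge p (int N - int (C1 + C2 + C3)) (of_int (d - 1) * zeta_value p n +
      of_int (\<Sum>a\<in>units_below p N. int (c * a mod p ^ N) ^ (n - 1) * int (c * a div p ^ N)))"
    if N: "0 < N" and c: "\<not> p dvd c" and d: "int (p ^ N) dvd int (c ^ n) - d" for N c d
  proof -
    let ?m = "2 * int N - int (C1 + C2)"
    define S where "S = (\<Sum>a\<in>units_below p N. int a ^ n)"
    define E where "E = (\<Sum>a\<in>units_below p N. int (c * a mod p ^ N) ^ (n - 1) * int (c * a div p ^ N))"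
    define \<delta> where "\<delta> = of_int S - of_nat p ^ N * G"
    have delta: "pval_ge p (2 * int N - int C1) \<delta>"
      using C1[OF N] by (simp add: \<delta>_def S_def)
    have pG: "pval_ge p (int N + - int C2) (of_nat p ^ N * G)"
      by (intro pval_ge_mult[OF p pval_ge_p_power[OF p] C2])
    have "pval_ge p (int N - int (C1 + C2)) (\<delta> + of_nat p ^ N * G)"
      by (intro pval_ge_add[OF p] pval_ge_mono[OF p delta] pval_ge_mono[OF p pG]) auto
    then have S: "pval_ge p (int N - int (C1 + C2)) (of_int S)" by (simp add: \<delta>_def)
    have cd: "pval_ge p (int N) (of_int (int (c ^ n) - d))"
      using pval_ge_of_int_dvd[OF p, of N "int (c ^ n) - d"] d unfolding of_nat_power by blast
    have "pval_ge p (int (N * 2)) (of_int ((int (c ^ n) - 1) * S - int n * int (p ^ N) * E))"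
      using units_sum_mult_mod[OF p c N, of n] unfolding S_def E_def
      by (intro pval_ge_of_int_dvd[OF p]) (simp add: power_mult)
    then have 1: "pval_ge p ?m (of_int ((int (c ^ n) - 1) * S - int n * int (p ^ N) * E))"
      by (rule pval_ge_mono[OF p]) simp
    have 2: "pval_ge p ?m (of_int (int (c ^ n) - d) * of_int S)"
      by (rule pval_ge_mono[OF p pval_ge_mult[OF p cd S]]) simp
    have 3: "pval_ge p ?m (of_int (d - 1) * \<delta>)"
      by (rule pval_ge_mono[OF p pval_ge_mult[OF p pval_ge_of_int[OF p] delta]]) simp
    \<comment> \<open>In this combination \<open>S\<close> cancels and p^N (n E - (d - 1) G)
      remains; division by n p^N leaves the precision N - C1 - C2 - C3.\<close>
    have "pval_ge p ?m (of_int (int (c ^ n) - d) * of_int S + of_int (d - 1) * \<delta> -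
        of_int ((int (c ^ n) - 1) * S - int n * int (p ^ N) * E))"
      by (intro pval_ge_add[OF p] pval_ge_diff[OF p] 1 2 3)
    also have "of_int (int (c ^ n) - d) * of_int S + of_int (d - 1) * \<delta> -
        of_int ((int (c ^ n) - 1) * S - int n * int (p ^ N) * E) =
        of_nat p ^ N * (of_nat n * of_int E - of_int (d - 1) * G)"
      by (simp add: \<delta>_def algebra_simps)
    finally have 4: "pval_ge p ?m (of_nat p ^ N * (of_nat n * of_int E - of_int (d - 1) * G))" .
    have "pval_ge p (- int N) (1 / of_nat p ^ N)"
      using pval_ge_inverse_of_nat[OF p, of "p ^ N" N] prime_gt_1_nat[OF p] by simp
    from pval_ge_mult[OF p C3 pval_ge_mult[OF p this 4]]
    have "pval_ge p (- int C3 + (- int N + ?m))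
        (1 / of_nat n * (1 / of_nat p ^ N * (of_nat p ^ N * (of_nat n * of_int E - of_int (d - 1) * G))))" .
    moreover have "1 / of_nat n * (1 / of_nat p ^ N * (of_nat p ^ N * (of_nat n * of_int E - of_int (d - 1) * G))) =
        of_int (d - 1) * zeta_value p n + of_int E"
      using n prime_gt_0_nat[OF p] by (simp add: zeta_value_def G_def field_simps)
    ultimately have "pval_ge p (- int C3 + (- int N + ?m)) (of_int (d - 1) * zeta_value p n + of_int E)"
      by (simp only:)
    then show ?thesis unfolding E_def by (rule pval_ge_mono[OF p]) simp
  qed
  then show ?thesis by blast
qed

section \<open>Termwise differences and the congruences of all orders\<close>

lemma fwd_diff_mult_left: "fwd_diff n (\<lambda>k. x * g k) = x * fwd_diff n g"
  by (simp add: fwd_diff_def sum_distrib_left mult_ac)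

lemma fwd_diff_add: "fwd_diff n (\<lambda>k. f k + g k) = fwd_diff n f + fwd_diff n g"
  by (simp add: fwd_diff_def distrib_left sum.distrib)

lemma fwd_diff_sum: "fwd_diff n (\<lambda>k. \<Sum>a\<in>A. f a k) = (\<Sum>a\<in>A. fwd_diff n (f a))"
  unfolding fwd_diff_def sum_distrib_left by (rule sum.swap)

lemma fwd_diff_power: "fwd_diff n (\<lambda>k. x ^ k) = (x - 1) ^ n"
  unfolding fwd_diff_def diff_conv_add_uminus binomial_ring atLeast0AtMost
  by (intro sum.cong refl) (simp only: mult_ac)

lemma fwd_diff_of_int: "fwd_diff n (\<lambda>k. of_int (g k)) = of_int (fwd_diff n g)"
  by (simp add: fwd_diff_def)

lemma pval_ge_fwd_diff:
  assumes p: "prime p" and "\<And>k. k \<le> n \<Longrightarrow> pval_ge p m (g k)"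
  shows "pval_ge p m (fwd_diff n g)"
  unfolding fwd_diff_def
proof (rule pval_ge_sum[OF p])
  fix k assume "k \<in> {0..n}"
  then have "pval_ge p (0 + m) (of_int (int (n choose k) * (-1) ^ (n - k)) * g k)"
    using assms by (intro pval_ge_mult[OF p pval_ge_of_int[OF p]]) auto
  then show "pval_ge p m (of_nat (n choose k) * (-1) ^ (n - k) * g k)" by simp
qed

lemma fermat_power_cong: "prime p \<Longrightarrow> [x ^ (p ^ N) = x] (mod p)" for x :: nat
proof (induction N)
  case (Suc N)
  have "[x ^ p = x] (mod p)"
  proof (cases "p dvd x")
    case True
    moreover have "p dvd x ^ p"
      by (rule dvd_trans[OF True dvd_power]) (simp add: prime_gt_0_nat Suc.prems)
    ultimately show ?thesis by (simp add: cong_def)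
  next
    case False
    have "x ^ p = x ^ (p - 1) * x" by (rule power_minus_mult[OF prime_gt_0_nat[OF Suc.prems], symmetric])
    then show ?thesis using cong_mult[OF fermat_theorem[OF Suc.prems False] cong_refl[of x p]] by simp
  qed
  then have "[(x ^ p) ^ (p ^ N) = x ^ (p ^ N)] (mod p)" by (rule cong_pow)
  with Suc show ?case by (auto simp: power_mult intro: cong_trans)
qed simp

text \<open>
  Raising \<open>c\<^sub>0\<close> to the power \<open>p\<^sup>N\<close> makes \<open>c\<^sup>p\<^sup>-\<^sup>1 \<equiv> 1\<close> modulo \<open>p\<^sup>N\<close>, so that the factor \<open>c\<^sup>n - 1\<close> does
  not depend on \<open>n\<close> within its residue class modulo \<open>p - 1\<close> and differences can be taken termwise.
\<close>

theorem kummer_congruence: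
  assumes p: "prime p" and l: "0 < l" "\<not> (p - 1) dvd l"
  shows "pval_ge p (int r) (fwd_diff r (\<lambda>k. zeta_value p (l + k * (p - 1))))"
proof -
  define n where "n k = l + k * (p - 1)" for k
  have n_pos: "0 < n k" for k using l(1) by (simp add: n_def)
  define P where "P k C \<longleftrightarrow>
    (\<forall>N>0. \<forall>c d. \<not> p dvd c \<longrightarrow> int (p ^ N) dvd int (c ^ n k) - d \<longrightarrow>
      pval_ge p (int N - int C) (of_int (d - 1) * zeta_value p (n k) +
        of_int (\<Sum>a\<in>units_below p N. int (c * a mod p ^ N) ^ (n k - 1) * int (c * a div p ^ N))))"
    for k C
  have "\<exists>C. P k C" for k
    unfolding P_def by (rule zeta_value_approx[OF p n_pos])
  then obtain C where "\<And>k. P k (C k)" by metis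
  then have C: "\<And>k N c d. 0 < N \<Longrightarrow> \<not> p dvd c \<Longrightarrow> int (p ^ N) dvd int (c ^ n k) - d \<Longrightarrow>
    pval_ge p (int N - int (C k)) (of_int (d - 1) * zeta_value p (n k) +
      of_int (\<Sum>a\<in>units_below p N. int (c * a mod p ^ N) ^ (n k - 1) * int (c * a div p ^ N)))"
    unfolding P_def by blast
  \<comment> \<open>Large enough that every approximation with \<open>k \<le> r\<close> holds modulo
    p^r; the successor makes \<open>N\<close> positive.\<close>
  define N where "N = Suc (r + (\<Sum>k\<le>r. C k))"
  obtain c0 where c0: "\<not> p dvd c0" "\<not> int p dvd int (c0 ^ l) - 1"
    using ex_power_not_cong_1[OF p l(2)] .
  define c where "c = c0 ^ (p ^ N)"
  define d where "d = int (c ^ l)"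
  have c: "\<not> p dvd c" unfolding c_def using c0(1) p by (auto dest: prime_dvd_power)
  \<comment> \<open>By Fermat \<open>c\<close> is congruent to \<open>c0\<close> modulo p, so d - 1
    is prime to p and can be divided out at the end.\<close>
  have d1: "\<not> int p dvd d - 1"
  proof
    assume "int p dvd d - 1"
    moreover have "[d = int (c0 ^ l)] (mod int p)"
      unfolding d_def c_def cong_int_iff by (intro cong_pow fermat_power_cong p)
    ultimately show False using c0(2) by (metis cong_iff_dvd_diff cong_sym cong_trans)
  qed
  have "[c0 ^ totient (p ^ Suc N) = 1] (mod p ^ Suc N)"
    using prime_imp_coprime[OF p c0(1)] by (intro euler_theorem) (simp add: coprime_commute)
  moreover have "totient (p ^ Suc N) = p ^ N * (p - 1)"
    using p by (rule totient_prime_power_Suc)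
  ultimately have "[c ^ (p - 1) = 1] (mod p ^ Suc N)" by (simp add: c_def power_mult)
  then have cp: "[c ^ (p - 1) = 1] (mod p ^ N)"
    by (rule cong_dvd_modulus_nat) (simp add: le_imp_power_dvd)
  have cn: "int (p ^ N) dvd int (c ^ n k) - d" for k
  proof -
    have "[c ^ l * (c ^ (p - 1)) ^ k = c ^ l * 1 ^ k] (mod p ^ N)"
      by (intro cong_mult cong_pow cp cong_refl)
    then have "[c ^ n k = c ^ l] (mod p ^ N)"
      by (simp add: n_def power_add mult.commute[of k] flip: power_mult)
    then show ?thesis unfolding d_def by (simp only: cong_int_iff flip: cong_iff_dvd_diff)
  qed
  let ?b = "\<lambda>a. int (c * a mod p ^ N)" and ?e = "\<lambda>a. int (c * a div p ^ N)"
  let ?E = "\<lambda>k. \<Sum>a\<in>units_below p N. ?b a ^ (n k - 1) * ?e a"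
  have "pval_ge p (int r) (fwd_diff r (\<lambda>k. of_int (d - 1) * zeta_value p (n k) + of_int (?E k)))"
  proof (rule pval_ge_fwd_diff[OF p])
    fix k assume "k \<le> r"
    then have "C k \<le> (\<Sum>k\<le>r. C k)" by (intro member_le_sum) auto
    then have "C k + r \<le> N" by (simp add: N_def)
    then have "int r \<le> int N - int (C k)" by linarith
    moreover have "0 < N" by (simp add: N_def)
    ultimately show "pval_ge p (int r) (of_int (d - 1) * zeta_value p (n k) + of_int (?E k))"
      using pval_ge_mono[OF p C[OF _ c cn]] by blast
  qed
  \<comment> \<open>In each summand \<open>k\<close> occurs only as the exponent of b^(p-1), so the
    \<open>r\<close>-th difference contains (b^(p-1) - 1)^r, which p^r divides by Fermat.\<close>
  moreover have "int p ^ r dvd fwd_diff r ?E"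
    unfolding fwd_diff_sum
  proof (rule dvd_sum)
    fix a assume a: "a \<in> units_below p N"
    have "\<not> p dvd c * a" using a c p by (simp add: units_below_def prime_dvd_mult_iff)
    moreover have "p dvd p ^ N" by (simp add: N_def)
    ultimately have "\<not> p dvd c * a mod p ^ N"
      using p by (simp add: dvd_mod_iff)
    then have "[(c * a mod p ^ N) ^ (p - 1) = 1] (mod p)"
      by (rule fermat_theorem[OF p])
    then have "int p dvd ?b a ^ (p - 1) - 1"
      by (metis cong_iff_dvd_diff cong_int_iff of_nat_1 of_nat_power)
    then have "int p ^ r dvd (?b a ^ (p - 1) - 1) ^ r" by (rule dvd_power_same)
    moreover have eq: "?b a ^ (n k - 1) * ?e a = (?b a ^ (l - 1) * ?e a) * (?b a ^ (p - 1)) ^ k" for k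
    proof -
      have "n k - 1 = (p - 1) * k + (l - 1)" using l by (simp add: n_def mult.commute add.commute)
      then show ?thesis by (simp add: power_add power_mult)
    qed
    ultimately show "int p ^ r dvd fwd_diff r (\<lambda>k. ?b a ^ (n k - 1) * ?e a)"
      unfolding eq fwd_diff_mult_left fwd_diff_power by (intro dvd_mult)
  qed
  then have "pval_ge p (int r) (fwd_diff r (\<lambda>k. of_int (?E k)))"
    unfolding fwd_diff_of_int by (rule pval_ge_of_int_dvd[OF p])
  ultimately have "pval_ge p (int r) (fwd_diff r (\<lambda>k. of_int (d - 1) * zeta_value p (n k)))"
    unfolding fwd_diff_add using pval_ge_diff[OF p] by fastforce
  then show ?thesis
    unfolding fwd_diff_mult_left n_def by (simp only: pval_ge_mult_unit_iff[OF p d1])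
qed

section \<open>The functions \<open>\<zeta>\<^sub>p\<^sub>,\<^sub>l\<close> and \<open>T\<^sub>p\<^sub>,\<^sub>l\<close>\<close>

lemma to_fract_of_nat: "to_fract (of_nat n) = of_nat n"
  by (induction n) simp_all

lemma to_fract_of_int: "to_fract (of_int n) = of_int n"
  by (cases n rule: int_cases2) (simp_all add: to_fract_of_nat)

lemma to_fract_numeral: "to_fract (numeral n) = numeral n"
  using to_fract_of_nat[of "numeral n"] by simp

text \<open>A denominator prime to p is a unit of Z_p. This carries valuation bounds in Q over to
  divisibility in Z_p.\<close>

lemma pval_ge_padic:
  assumes "pval_ge CARD('p) (int k) x"
  shows "\<exists>z :: 'p::prime_card padic_int. to_fract z = of_rat x \<and> of_nat CARD('p) ^ k dvd z"
proof -
  obtain a b where b: "\<not> int CARD('p) dvd b" and x: "x = of_nat CARD('p) ^ k * of_int a / of_int b"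
    using assms unfolding pval_ge_def by auto
  obtain w where w: "1 = (of_int b :: 'p padic_int) * w"
    using is_unit_padic_of_int[OF b] by (rule dvdE)
  define z :: "'p padic_int" where "z = of_nat CARD('p) ^ k * (of_int a * w)"
  have "of_int b * z = of_nat CARD('p) ^ k * of_int a * (of_int b * w)"
    by (simp only: z_def mult_ac)
  then have "of_int b * z = of_int (int CARD('p) ^ k * a)" unfolding w[symmetric] by simp
  then have "to_fract (of_int b * z) = to_fract (of_int (int CARD('p) ^ k * a))" by simp
  then have "of_int b * to_fract z = (of_int (int CARD('p) ^ k * a) :: 'p padic_int fract)"
    by (simp only: to_fract_mult to_fract_of_int)
  moreover have "b \<noteq> 0" using b by auto
  ultimately have "to_fract z = (of_int (int CARD('p) ^ k * a) / of_int b :: 'p padic_int fract)"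
    by (simp add: field_simps)
  also have "\<dots> = of_rat (of_int (int CARD('p) ^ k * a) / of_int b)"
    by (simp only: of_rat_divide of_rat_of_int_eq)
  also have "of_int (int CARD('p) ^ k * a) / of_int b = x" by (simp add: x)
  finally show ?thesis by (intro exI[of _ z]) (simp add: z_def)
qed

lemma pval_ge_imp_padic_dvd:
  fixes z :: "'p::prime_card padic_int"
  assumes "pval_ge CARD('p) (int k) x" "to_fract z = of_rat x"
  shows "of_nat CARD('p) ^ k dvd z"
  using pval_ge_padic[OF assms(1)] assms(2) by (metis to_fract_eq_iff)

text \<open>Newton interpolation of the zeta values; 0 < l < p - 1 rules out that p - 1 divides
  \<open>l\<close>, so the Kummer congruences apply. Continuity and density identify the series with
  \<open>zeta\<close>.\<close>

lemma zeta_eq_mahler: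
  assumes p: "p = CARD('p::prime_card)" and l: "0 < l" "l < p - 1"
  obtains c where "c \<in> kummer_coeffs" and "(zeta l :: 'p padic_int \<Rightarrow> 'p padic_int) = mahler c"
    and "\<And>k. to_fract (c k) = of_rat (fwd_diff k (\<lambda>j. zeta_value p (l + j * (p - 1))))"
proof -
  define g where "g j = zeta_value p (l + j * (p - 1))" for j
  have "prime p" using prime_card[where 'a='p] p by simp
  moreover have "\<not> (p - 1) dvd l" using l by (auto dest: dvd_imp_le)
  ultimately have "pval_ge CARD('p) (int k) (fwd_diff k g)" for k
    unfolding g_def using kummer_congruence[OF _ l(1)] p by blast
  then have "\<exists>z :: 'p padic_int. to_fract z = of_rat (fwd_diff k g) \<and> of_nat CARD('p) ^ k dvd z" for k
    by (rule pval_ge_padic)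
  then obtain c :: "nat \<Rightarrow> 'p padic_int" where
    c: "\<And>k. to_fract (c k) = of_rat (fwd_diff k g)" "\<And>k. of_nat CARD('p) ^ k dvd c k"
    by metis
  have K: "c \<in> kummer_coeffs" using c(2) by (simp add: kummer_coeffs_def)
  \<comment> \<open>The shift \<open>n\<close> stays general because the step from \<open>m\<close>
    to \<open>m + 1\<close> involves the next difference.\<close>
  have interp: "to_fract (mahler (\<lambda>k. c (k + n)) (of_nat m)) = of_rat (fwd_diff n (\<lambda>j. g (j + m)))" for m n
  proof (induction m arbitrary: n)
    case 0
    show ?case using mahler_0[OF kummer_coeffs_shift[OF K]] by (simp add: c(1))
  next
    case (Suc m)
    have step: "mahler (\<lambda>k. c (k + n)) (of_nat (Suc m)) =
        mahler (\<lambda>k. c (k + n)) (of_nat m) + mahler (\<lambda>k. c (k + Suc n)) (of_nat m)"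
      using mahler_plus_1[OF kummer_coeffs_shift[OF K, of n], of "of_nat m"] by (simp add: add.commute)
    show ?case
      unfolding step to_fract_add Suc.IH fwd_diff_Suc by (simp add: of_rat_diff)
  qed
  have interp0: "to_fract (mahler c (of_nat s)) = of_rat (g s)" for s
    using interp[of 0 s] by simp
  let ?Q = "\<lambda>f. continuous_on UNIV f \<and>
    (\<forall>s::nat. let n = l + s * (CARD('p) - 1) in
        to_fract (f (of_nat s) :: 'p padic_int) =
          of_rat (- (1 - of_nat CARD('p) ^ (n - 1)) * bernoulli n / of_nat n))"
  have Q: "?Q (mahler c)"
    using continuous_mahler[OF K] interp0 p by (simp add: Let_def g_def zeta_value_def)
  have unique: "f = mahler c" if "?Q f" for f
  proof (rule continuous_padic_eqI)
    fix m
    have "to_fract (f (of_nat m)) = to_fract (mahler c (of_nat m))"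
      using that Q by (simp only: Let_def)
    then show "f (of_nat m) = mahler c (of_nat m)" by simp
  qed (use that Q in auto)
  have "(zeta l :: 'p padic_int \<Rightarrow> 'p padic_int) = mahler c"
    unfolding zeta_def by (rule the_equality[where P = ?Q, OF Q unique])
  with K c(1) show ?thesis unfolding g_def by (intro that)
qed

section \<open>The function T and its values at 0 and 1\<close>

lemma card_dvd_power_minus_1:
  assumes "a \<in> {1..CARD('p::prime_card) - 1}"
  shows "int CARD('p) dvd int a ^ (CARD('p) - 1) - 1"
proof -
  have "\<not> CARD('p) dvd a" using assms by (auto dest: dvd_imp_le)
  then have "[a ^ (CARD('p) - 1) = 1] (mod CARD('p))"
    by (rule fermat_theorem[OF prime_card])
  then have "[int (a ^ (CARD('p) - 1)) = int 1] (mod int CARD('p))" by (simp only: cong_int_iff)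
  then show ?thesis by (simp add: cong_iff_dvd_diff)
qed

lemma padic_card_dvd_power_minus_1:
  assumes "a \<in> {1..CARD('p::prime_card) - 1}"
  shows "of_nat CARD('p) dvd (of_nat a ^ (CARD('p) - 1) - 1 :: 'p padic_int)"
  using card_dvd_power_minus_1[OF assms] padic_power_dvd_of_int_iff[of 1 "int a ^ (CARD('p) - 1) - 1", where 'p='p]
  by simp

lemma T_in_kummer_space: "(T l :: 'p::prime_card padic_int \<Rightarrow> 'p padic_int) \<in> kummer_space"
proof -
  let ?w = "\<lambda>a. of_nat a ^ l * fermat_quotient (of_nat a) :: 'p padic_int"
  have "padic_pow (of_nat a ^ (CARD('p) - 1)) \<in> (kummer_space :: ('p padic_int \<Rightarrow> 'p padic_int) set)"
    if "a \<in> {1..CARD('p) - 1}" for a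
    unfolding padic_pow_eq_mahler
    by (rule mahler_in_kummer_space[OF power_in_kummer_coeffs[OF padic_card_dvd_power_minus_1[OF that]]])
  from kummer_space_linear_combination[OF this, where w = ?w]
  show ?thesis unfolding T_def[abs_def] .
qed

lemma T_cong_T_0:
  fixes s :: "'p::prime_card padic_int"
  shows "of_nat CARD('p) dvd T l s - T l 0"
proof -
  have "of_nat CARD('p) dvd padic_pow (of_nat a ^ (CARD('p) - 1)) s - padic_pow (of_nat a ^ (CARD('p) - 1)) (0 :: 'p padic_int)"
    if "a \<in> {1..CARD('p) - 1}" for a
  proof -
    note c = power_in_kummer_coeffs[OF padic_card_dvd_power_minus_1[OF that]]
    show ?thesis
      unfolding padic_pow_eq_mahler mahler_0[OF c] by (rule mahler_cong_coeff_0[OF c])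
  qed
  then have "of_nat CARD('p) dvd (\<Sum>a=1..CARD('p) - 1. of_nat a ^ l * fermat_quotient (of_nat a) *
      (padic_pow (of_nat a ^ (CARD('p) - 1)) s - padic_pow (of_nat a ^ (CARD('p) - 1)) (0 :: 'p padic_int)))"
    by (intro dvd_sum dvd_mult) auto
  then show ?thesis by (simp only: T_def right_diff_distrib sum_subtractf)
qed

lemma card_mult_fermat_quotient:
  assumes "a \<in> {1..CARD('p::prime_card) - 1}"
  shows "of_nat CARD('p) * fermat_quotient (of_nat a) = (of_nat a ^ (CARD('p) - 1) - 1 :: 'p padic_int)"
  unfolding fermat_quotient_def
  by (rule dvd_mult_div_cancel[OF padic_card_dvd_power_minus_1[OF assms]])

text \<open>As p q(a) = a^(p-1) - 1, each term times p is a difference of two powers of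
  \<open>a\<close>. The hypothesis \<open>pow\<close> is supplied for j = 0 and j = 1.\<close>

lemma T_eq_power_sums:
  fixes s :: "'p::prime_card padic_int"
  assumes l: "0 < l" and s: "s = of_nat j"
    and pow: "\<And>a. a \<in> {1..CARD('p) - 1} \<Longrightarrow>
      padic_pow (of_nat a ^ (CARD('p) - 1)) s = (of_nat a ^ (CARD('p) - 1)) ^ j"
  shows "to_fract (T l s) = of_rat (((\<Sum>a<CARD('p). of_nat a ^ (l + Suc j * (CARD('p) - 1))) -
    (\<Sum>a<CARD('p). of_nat a ^ (l + j * (CARD('p) - 1)))) / of_nat CARD('p))"
proof -
  let ?q = "CARD('p) - 1"
  define R where "R = (\<Sum>a<CARD('p). int a ^ (l + Suc j * ?q)) - (\<Sum>a<CARD('p). int a ^ (l + j * ?q))"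
  have p: "0 < CARD('p)" using prime_card[where 'a='p] by (rule prime_gt_0_nat)
  \<comment> \<open>The index 0 can be added to the sums because \<open>0 < l\<close> makes the
    exponents positive.\<close>
  then have range: "{..<CARD('p)} = insert 0 {1..?q}" by auto
  have "of_nat CARD('p) * T l s = (\<Sum>a=1..?q. of_int (int a ^ (l + Suc j * ?q) - int a ^ (l + j * ?q)))"
    unfolding T_def sum_distrib_left
  proof (rule sum.cong[OF refl])
    fix a assume a: "a \<in> {1..?q}"
    have "of_nat CARD('p) * (of_nat a ^ l * fermat_quotient (of_nat a) * padic_pow (of_nat a ^ ?q) s) =
        of_nat a ^ l * (of_nat CARD('p) * fermat_quotient (of_nat a)) * (of_nat a ^ ?q) ^ j"
      unfolding pow[OF a] by (simp only: mult_ac)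
    also have "\<dots> = of_nat a ^ l * (of_nat a ^ ?q - 1) * (of_nat a ^ ?q) ^ j"
      unfolding card_mult_fermat_quotient[OF a] ..
    also have "\<dots> = of_int (int a ^ (l + Suc j * ?q) - int a ^ (l + j * ?q))"
      by (simp only: of_int_diff of_int_mult of_int_power of_int_of_nat_eq power_add mult_Suc power_mult[symmetric]
          left_diff_distrib right_diff_distrib mult_1_right mult_1_left mult_ac)
    finally show "of_nat CARD('p) * (of_nat a ^ l * fermat_quotient (of_nat a) * padic_pow (of_nat a ^ ?q) s) =
        of_int (int a ^ (l + Suc j * ?q) - int a ^ (l + j * ?q))" .
  qed
  also have "\<dots> = of_int R"
    unfolding R_def range using l by (simp add: sum_subtractf power_0_left)
  finally have "to_fract (of_nat CARD('p) * T l s) = to_fract (of_int R)" by simp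
  then have "of_nat CARD('p) * to_fract (T l s) = (of_int R :: 'p padic_int fract)"
    by (simp only: to_fract_mult to_fract_of_int to_fract_of_nat)
  then have "to_fract (T l s) = (of_int R / of_nat CARD('p) :: 'p padic_int fract)"
    using p by (simp add: field_simps)
  also have "\<dots> = of_rat (of_int R / of_nat CARD('p))"
    by (simp only: of_rat_divide of_rat_of_int_eq of_rat_of_nat_eq)
  finally show ?thesis by (simp add: R_def)
qed

section \<open>The invariant Delta\<close>

text \<open>A natural approximation reduced modulo p exists, and congruent residues in [0,p) are
  equal, so the \<open>THE\<close> in \<open>Delta\<close> is well defined.\<close>

lemma Delta_residue:
  fixes f :: "'p::prime_card padic_int \<Rightarrow> 'p padic_int"
  shows "0 \<le> Delta f" "Delta f < int CARD('p)" "of_nat CARD('p) dvd of_int (Delta f) - Delta_coeff f 1"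
proof -
  let ?x = "Delta_coeff f 1"
  let ?Q = "\<lambda>d. 0 \<le> d \<and> d < int CARD('p) \<and> of_nat CARD('p) dvd of_int d - ?x"
  have "\<exists>!d. ?Q d"
  proof (rule ex_ex1I)
    obtain m where "of_nat CARD('p) ^ 1 dvd ?x - of_nat m" using padic_approx_nat by blast
    then have m: "of_nat CARD('p) dvd ?x - of_nat m" by simp
    have r: "(of_nat m :: 'p padic_int) = of_nat CARD('p) * of_nat (m div CARD('p)) + of_nat (m mod CARD('p))"
      by (simp only: mult_div_mod_eq flip: of_nat_mult of_nat_add)
    have "x - c = x - a + b" if "a = b + c" for a b c x :: "'p padic_int"
      using that by simp
    from this[OF r] have "of_nat CARD('p) dvd ?x - of_nat (m mod CARD('p))"
      using dvd_add[OF m dvd_triv_left] by (simp only:)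
    then have "of_nat CARD('p) dvd of_int (int (m mod CARD('p))) - ?x"
      unfolding of_int_of_nat_eq by (subst dvd_minus_iff[symmetric]) (simp only: minus_diff_eq)
    then have "?Q (int (m mod CARD('p)))"
      using prime_gt_0_nat[OF prime_card[where 'a='p]] by (intro conjI) simp_all
    then show "\<exists>d. ?Q d" by blast
  next
    fix d e assume d: "?Q d" and e: "?Q e"
    then have "of_nat CARD('p) dvd (of_int d - ?x) - (of_int e - ?x)"
      using dvd_diff[of "of_nat CARD('p)" "of_int d - ?x" "of_int e - ?x"] by blast
    then have "of_nat CARD('p) ^ 1 dvd (of_int (d - e) :: 'p padic_int)" by simp
    then have "int CARD('p) dvd d - e" using padic_power_dvd_of_int_iff[of 1 "d - e", where 'p='p] by simp
    then have "d mod int CARD('p) = e mod int CARD('p)" by (simp add: mod_eq_dvd_iff)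
    then show "d = e" using d e by simp
  qed
  from theI'[OF this] show "0 \<le> Delta f" "Delta f < int CARD('p)" "of_nat CARD('p) dvd of_int (Delta f) - ?x"
    unfolding Delta_def by auto
qed

lemma Delta_eq_0_iff:
  fixes f :: "'p::prime_card padic_int \<Rightarrow> 'p padic_int"
  shows "Delta f = 0 \<longleftrightarrow> of_nat CARD('p) dvd (of_int (Delta f) :: 'p padic_int)"
proof -
  have "of_nat CARD('p) dvd (of_int (Delta f) :: 'p padic_int) \<longleftrightarrow> int CARD('p) dvd Delta f"
    using padic_power_dvd_of_int_iff[of 1 "Delta f", where 'p='p] by simp
  then show ?thesis using Delta_residue(1,2)[of f] zdvd_not_zless[of "Delta f" "int CARD('p)"] by force
qed

lemma fdiff_1: "fdiff 1 f s = f (s + 1) - f s"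
  using fdiff_Suc[of 0 f s] by simp

section \<open>Power sums against zeta values\<close>

lemma bernoulli_eq_zeta_value:
  assumes "0 < n"
  shows "bernoulli n = of_nat p ^ (n - 1) * bernoulli n - of_nat n * zeta_value p n"
proof -
  have "of_nat n * zeta_value p n = - (1 - of_nat p ^ (n - 1)) * bernoulli n"
    using assms by (simp add: zeta_value_def)
  then show ?thesis by (simp add: algebra_simps)
qed

text \<open>Division by p turns \<open>S\<close> into a congruence of S_n/p with B_n modulo p^k; the
  Euler correction p^(n-1) B_n is absorbed because k <= n - 1 and B_n is p-integral.\<close>

lemma pval_ge_power_sum_minus_zeta_value:
  assumes p: "prime p" "3 < p" and n: "0 < n" "\<not> (p - 1) dvd n" and k: "k < n"
    and S: "pval_ge p (int (Suc k)) ((\<Sum>a<p. of_nat a ^ n) - of_nat p * bernoulli n)"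
  shows "pval_ge p (int k) ((\<Sum>a<p. of_nat a ^ n) / of_nat p + of_nat n * zeta_value p n)"
proof -
  let ?S = "\<Sum>a<p. of_nat a ^ n :: rat"
  have p2: "2 < p" using p by simp
  have "pval_ge p (-1) (1 / of_nat p)"
    using pval_ge_inverse_of_nat[OF p(1), of p 1] p by simp
  from pval_ge_mult[OF p(1) S this]
  have 1: "pval_ge p (int k) ((?S - of_nat p * bernoulli n) * (1 / of_nat p))" by simp
  have "pval_ge p (int (n - 1) + 0) (of_nat p ^ (n - 1) * bernoulli n)"
    by (intro pval_ge_mult[OF p(1) pval_ge_p_power[OF p(1)] pval_ge_bernoulli_0[OF p(1) p2 n(2)]])
  then have 2: "pval_ge p (int k) (of_nat p ^ (n - 1) * bernoulli n)"
    by (rule pval_ge_mono[OF p(1)]) (use k in simp)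
  have "pval_ge p (int k) ((?S - of_nat p * bernoulli n) * (1 / of_nat p) + of_nat p ^ (n - 1) * bernoulli n)"
    by (rule pval_ge_add[OF p(1) 1 2])
  also have "(?S - of_nat p * bernoulli n) * (1 / of_nat p) + of_nat p ^ (n - 1) * bernoulli n =
      ?S / of_nat p + of_nat n * zeta_value p n"
    using bernoulli_eq_zeta_value[OF n(1), of p] p by (simp add: diff_divide_distrib left_diff_distrib)
  finally show ?thesis .
qed

theorem theorem9p3:
  fixes p l :: nat
  assumes "p = CARD('p::prime_card)" and "3 < p"
    and "even l" and "0 < l" and "l < p - 1"
  shows "(\<forall>s :: 'p padic_int. of_nat p dvd T l s - zeta l s) \<and>
    (l \<noteq> 2 \<longrightarrow>
      (of_nat p :: 'p padic_int) dvd
        of_int (Delta (T l :: 'p padic_int \<Rightarrow> 'p padic_int)) -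
        2 * of_int (Delta (zeta l :: 'p padic_int \<Rightarrow> 'p padic_int))) \<and>
    (is_unit (T l (0 :: 'p padic_int)) \<longleftrightarrow> is_unit (zeta l (0 :: 'p padic_int))) \<and>
    ((T l :: 'p padic_int \<Rightarrow> 'p padic_int) \<in> W0 \<longleftrightarrow>
      (zeta l :: 'p padic_int \<Rightarrow> 'p padic_int) \<in> W0)"
proof -
  let ?T = "T l :: 'p padic_int \<Rightarrow> 'p padic_int" and ?Z = "zeta l :: 'p padic_int \<Rightarrow> 'p padic_int"
  let ?P = "of_nat p :: 'p padic_int"
  note p = assms(1)
  have pr: "prime p" using prime_card[where 'a='p] p by simp
  have odd_p: "odd p" using pr assms(2) by (intro prime_odd_nat) auto

  \<comment> \<open>Rational congruences along the exponents l + j (p - 1)\<close>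
  define n where "n j = l + j * (p - 1)" for j
  define g where "g j = zeta_value p (n j)" for j
  \<comment> \<open>T(0) and T(1) will be A 1 - A 0 and A 2 - A 1. The error \<open>E j\<close>
    compares \<open>A j\<close> with -n_j g_j, which stands for B_n.\<close>
  define A :: "nat \<Rightarrow> rat" where "A j = (\<Sum>a<p. of_nat a ^ n j) / of_nat p" for j
  define E where "E j = A j + of_nat (n j) * g j" for j
  have l2: "2 \<le> l" using assms(3,4) by (cases "l = 1") auto
  have n_ge: "l \<le> n j" for j by (simp add: n_def)
  have n_even: "even (n j)" for j using assms(3) odd_p by (simp add: n_def)
  have shift_dvd: "(p - 1) dvd n j - i \<longleftrightarrow> (p - 1) dvd l - i" if "i \<le> l" for i j
  proof -
    have "n j - i = (l - i) + j * (p - 1)" using that by (simp add: n_def)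
    then show ?thesis by simp
  qed
  have n_ndvd: "\<not> (p - 1) dvd n j" for j
    using shift_dvd[of 0 j] assms(4,5) by (auto dest: dvd_imp_le)
  have n1_ndvd: "\<not> (p - 1) dvd n j - 1" for j
    using shift_dvd[of 1 j] l2 assms(5) by (auto dest: dvd_imp_le)
  have E1: "pval_ge p 1 (E j)" for j
  proof -
    have "pval_ge p (int 1) (E j)"
      unfolding E_def A_def g_def
      using pval_ge_power_sum_minus_bernoulli_2[OF pr assms(2) n1_ndvd] n_ge[of j] l2
      by (intro pval_ge_power_sum_minus_zeta_value pr assms(2) n_ndvd) simp_all
    then show ?thesis by simp
  qed
  \<comment> \<open>An even \<open>l\<close> other than 2 exceeds 2, so 0 < l - 2 < p - 1 and the
    bound modulo p^3 applies.\<close>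
  have E2: "pval_ge p 2 (E j)" if "l \<noteq> 2" for j
  proof -
    have l4: "2 < l" using l2 that by simp
    then have "\<not> (p - 1) dvd n j - 2"
      using shift_dvd[of 2 j] assms(5) by (auto dest: dvd_imp_le)
    then have "pval_ge p 3 ((\<Sum>a<p. of_nat a ^ n j) - of_nat p * bernoulli (n j))"
      using n_ge[of j] l4 by (intro pval_ge_power_sum_minus_bernoulli_3 pr assms(2) n_even) auto
    then have "pval_ge p (int 2) (E j)"
      unfolding E_def A_def g_def
      using n_ge[of j] l4
      by (intro pval_ge_power_sum_minus_zeta_value pr assms(2) n_ndvd) simp_all
    then show ?thesis by simp
  qed
  have kummer: "pval_ge p (int r) (fwd_diff r g)" for r
    unfolding g_def n_def using n_ndvd[of 0] assms(4)
    by (intro kummer_congruence[OF pr]) (simp_all add: n_def)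
  define D1 where "D1 = g 1 - g 0"
  define D2 where "D2 = g 2 - 2 * g 1 + g 0"
  have g0: "pval_ge p 0 (g 0)" using kummer[of 0] by simp
  have D1_fwd: "fwd_diff 1 g = D1" using fwd_diff_Suc[of 0 g] by (simp add: D1_def)
  have D1: "pval_ge p 1 D1" using kummer[of 1] unfolding D1_fwd by simp
  have "fwd_diff 2 g = D2"
    using fwd_diff_Suc[of 1 g] fwd_diff_Suc[of 0 g] fwd_diff_Suc[of 0 "\<lambda>k. g (Suc k)"]
    by (simp add: D2_def numeral_2_eq_2)
  then have D2: "pval_ge p 2 D2" using kummer[of 2] by simp
  have pp: "pval_ge p 1 (of_nat p)" using pval_ge_p_power[OF pr, of 1] by simp
  have of_nat_n: "(of_nat (n j) :: rat) = of_nat l + of_nat j * (of_nat p - 1)" for j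
    using assms(2) by (simp add: n_def of_nat_diff)

  \<comment> \<open>Here n_1 g_1 - n_0 g_0 = -g_0 + (l - 1) D1 + p g_1, and the last two terms
    vanish modulo p.\<close>
  have T0_rat: "pval_ge p (int 1) (A 1 - A 0 - g 0)"
  proof -
    have g1: "pval_ge p 0 (g 1)"
      using pval_ge_add[OF pr g0 pval_ge_mono[OF pr D1, of 0]] by (simp add: D1_def)
    have "pval_ge p 1 (of_int (int l - 1) * D1)" "pval_ge p 1 (of_nat p * g 1)"
      using pval_ge_mult[OF pr pval_ge_of_int[OF pr, of "int l - 1"] D1] pval_ge_mult[OF pr pp g1] by simp_all
    then have "pval_ge p 1 (E 1 - E 0 - of_int (int l - 1) * D1 - of_nat p * g 1)"
      by (intro pval_ge_diff[OF pr] E1)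
    also have "E 1 - E 0 - of_int (int l - 1) * D1 - of_nat p * g 1 = A 1 - A 0 - g 0"
      by (simp add: E_def D1_def of_nat_n algebra_simps)
    finally show ?thesis by simp
  qed
  \<comment> \<open>The second difference of n_j g_j is -2 D1 + (l - 2) D2 + 2 p (D2 + D1), and all
    but the first term vanish modulo p^2.\<close>
  have T1_rat: "pval_ge p (int 2) (A 2 - A 1 - (A 1 - A 0) - 2 * D1)" if "l \<noteq> 2"
  proof -
    have "pval_ge p 2 (2 * E 1)" "pval_ge p 2 (of_int (int l - 2) * D2)"
      using pval_ge_mult[OF pr pval_ge_of_int[OF pr, of 2] E2[OF that]]
        pval_ge_mult[OF pr pval_ge_of_int[OF pr, of "int l - 2"] D2] by simp_all
    moreover have "pval_ge p 2 (2 * (of_nat p * (D2 + D1)))"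
      using pval_ge_mult[OF pr pval_ge_of_int[OF pr, of 2]
          pval_ge_mult[OF pr pp pval_ge_add[OF pr pval_ge_mono[OF pr D2, of 1] D1]]] by simp
    ultimately have "pval_ge p 2 (E 2 - 2 * E 1 + E 0 - of_int (int l - 2) * D2 - 2 * (of_nat p * (D2 + D1)))"
      by (intro pval_ge_diff[OF pr] pval_ge_add[OF pr] E2 that)
    also have "E 2 - 2 * E 1 + E 0 - of_int (int l - 2) * D2 - 2 * (of_nat p * (D2 + D1)) =
        A 2 - A 1 - (A 1 - A 0) - 2 * D1"
      by (simp add: E_def D1_def D2_def of_nat_n algebra_simps)
    finally show ?thesis by simp
  qed

  \<comment> \<open>Transfer of the rational congruences to Z_p\<close>
  obtain c where K: "c \<in> kummer_coeffs" and Z: "?Z = mahler c"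
    and c: "\<And>k. to_fract (c k) = of_rat (fwd_diff k g)"
    using zeta_eq_mahler[OF p assms(4,5)] unfolding g_def n_def by blast
  have Z0: "?Z 0 = c 0" unfolding Z by (rule mahler_0[OF K])
  have dZ: "fdiff 1 ?Z 0 = c 1"
    unfolding Z fdiff_mahler[OF K] using mahler_0[OF kummer_coeffs_shift[OF K, of 1]] by simp
  have ZK: "?Z \<in> kummer_space" unfolding Z by (rule mahler_in_kummer_space[OF K])
  have TK: "?T \<in> kummer_space" by (rule T_in_kummer_space)
  have T0: "to_fract (?T 0) = of_rat (A 1 - A 0)"
    using T_eq_power_sums[OF assms(4), of "0 :: 'p padic_int" 0]
      padic_pow_0[OF padic_card_dvd_power_minus_1[where 'p='p]]
    by (simp add: A_def n_def p diff_divide_distrib)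
  have T1: "to_fract (?T 1) = of_rat (A 2 - A 1)"
    using T_eq_power_sums[OF assms(4), of "1 :: 'p padic_int" 1]
      padic_pow_1[OF padic_card_dvd_power_minus_1[where 'p='p]]
    by (simp add: A_def n_def p diff_divide_distrib numeral_2_eq_2)

  have cong0: "?P dvd ?T 0 - ?Z 0"
  proof -
    have "to_fract (?T 0 - ?Z 0) = of_rat (A 1 - A 0 - g 0)"
      by (simp add: T0 Z0 c of_rat_diff)
    then have "?P ^ 1 dvd ?T 0 - ?Z 0"
      using pval_ge_imp_padic_dvd[of 1] T0_rat unfolding p by blast
    then show ?thesis by simp
  qed
  \<comment> \<open>Both functions are constant modulo p, so the congruence at 0 suffices.\<close>
  have part1: "?P dvd ?T s - ?Z s" for s
  proof -
    have Ts: "?P dvd ?T s - ?T 0" and Zs: "?P dvd ?Z s - c 0"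
      using T_cong_T_0[of l s] mahler_cong_coeff_0[OF K, of s] by (simp_all only: p Z)
    from dvd_diff[OF dvd_add[OF Ts cong0] Zs]
    show ?thesis by (simp add: Z0)
  qed
  have part2: "?P dvd of_int (Delta ?T) - 2 * of_int (Delta ?Z)" if "l \<noteq> 2"
  proof -
    have D: "?P * Delta_coeff f 1 = fdiff 1 f 0" if "f \<in> kummer_space" for f
    proof -
      have "?P ^ 1 dvd fdiff 1 f 0" using that unfolding kummer_space_def p by blast
      then show ?thesis unfolding Delta_coeff_def p by (simp add: dvd_mult_div_cancel)
    qed
    have "to_fract (fdiff 1 ?T 0 - 2 * c 1) = to_fract (?T 1) - to_fract (?T 0) - (to_fract (c 1) + to_fract (c 1))"
      by (simp only: fdiff_1 to_fract_diff to_fract_add add_0_left mult_2)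
    also have "\<dots> = of_rat (A 2 - A 1 - (A 1 - A 0) - 2 * D1)"
      unfolding T0 T1 c D1_fwd by (simp only: of_rat_diff of_rat_add mult_2)
    finally have "?P ^ 2 dvd fdiff 1 ?T 0 - 2 * c 1"
      using pval_ge_imp_padic_dvd[of 2] T1_rat[OF that] unfolding p by blast
    \<comment> \<open>The congruence of first differences modulo p^2 is divided by p; then the
      coefficients are replaced by their residues.\<close>
    then have "?P ^ 2 dvd ?P * Delta_coeff ?T 1 - 2 * (?P * Delta_coeff ?Z 1)"
      by (simp only: D[OF TK] D[OF ZK] dZ)
    then have "?P * ?P dvd ?P * (Delta_coeff ?T 1 - 2 * Delta_coeff ?Z 1)"
      by (simp add: power2_eq_square right_diff_distrib mult.left_commute)
    then have coeff: "?P dvd Delta_coeff ?T 1 - 2 * Delta_coeff ?Z 1"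
      using assms(2) by simp
    have dT: "?P dvd of_int (Delta ?T) - Delta_coeff ?T 1"
      and dZ: "?P dvd of_int (Delta ?Z) - Delta_coeff ?Z 1"
      unfolding p by (rule Delta_residue(3))+
    from dvd_diff[OF dvd_add[OF dT coeff] dvd_mult[OF dZ, of 2]]
    show ?thesis by (simp add: algebra_simps)
  qed
  have dvd0: "?P dvd ?T 0 \<longleftrightarrow> ?P dvd ?Z 0"
    using dvd_add_right_iff[OF cong0, of "?Z 0"] by simp
  have part3: "is_unit (?T 0) \<longleftrightarrow> is_unit (?Z 0)"
    using dvd0 by (simp add: padic_is_unit_iff p)
  have part4: "?T \<in> W0 \<longleftrightarrow> ?Z \<in> W0"
  proof (cases "l = 2")
    case True
    \<comment> \<open>Since B_2 = 1/6, 12 zeta(0) = p - 1. So p divides neither value at 0, and both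
      functions fail the first condition of \<open>W0\<close>.\<close>
    have "to_fract (12 * ?Z 0) = of_rat (12 * g 0)"
      by (simp add: Z0 c to_fract_numeral of_rat_mult)
    also have "12 * g 0 = of_nat p - 1"
      using True assms(2) by (simp add: g_def n_def zeta_value_def bernoulli_2)
    also have "of_rat (of_nat p - 1) = to_fract (?P - 1)"
      by (simp add: to_fract_of_nat of_rat_diff)
    finally have Z12: "12 * ?Z 0 = ?P - 1" by (simp only: to_fract_eq_iff)
    have "\<not> ?P dvd ?Z 0"
    proof
      assume "?P dvd ?Z 0"
      then have "?P dvd ?P - 12 * ?Z 0" by simp
      then have "?P dvd 1" unfolding Z12 by simp
      then show False using padic_is_unit_iff[of ?P] p by simp
    qed
    then show ?thesis using dvd0 by (simp add: W0_def p)
  next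
    case False
    \<comment> \<open>As 2 is a unit, the congruence makes both invariants divisible by p together;
      lying in [0,p), they vanish together.\<close>
    have two: "is_unit (2 :: 'p padic_int)"
      using is_unit_padic_of_int[of 2, where 'p='p] assms(2) p zdvd_not_zless[of 2 "int CARD('p)"] by simp
    have "?P dvd of_int (Delta ?T) \<longleftrightarrow> ?P dvd 2 * of_int (Delta ?Z)"
      using dvd_add_right_iff[OF part2[OF False], of "2 * of_int (Delta ?Z)"] by simp
    also have "\<dots> \<longleftrightarrow> ?P dvd of_int (Delta ?Z)"
      using two by (simp add: dvd_mult_unit_iff')
    finally have "Delta ?T = 0 \<longleftrightarrow> Delta ?Z = 0"
      unfolding Delta_eq_0_iff p .
    then show ?thesis using TK ZK dvd0 by (simp add: W0_def p)
  qed
  show ?thesis using part1 part2 part3 part4 by blast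
qed

end
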